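(* Let $n\ge 2$. The free generators of the algebra $T(V^{(n-1,1)})^{\mathfrak S_n}$ are counted by the words which reduce to the identity without crossing the identity in $\Gamma(\mathfrak S_n,\{(1\,2),(1\,3\,2),\dots,(1\,n\,\cdots\,4\,3\,2)\})$; that is, for every $d\ge1$, the number of generators of degree $d$ in a homogeneous free generating set of $T(V^{(n-1,1)})^{\mathfrak S_n}$ equals the number of words of length $d$ in this Cayley graph which reduce to the identity without crossing the identity.
   Context: $\mathfrak S_n$ is the symmetric group on $\{1,\dots,n\}$. $V^{(n-1,1)}$ is the geometric $\mathfrak S_n$-module: the $\mathbb Q$-span of $x_i-x_{i+1}$, $1\le i\le n-1$, inside the permutation module with basis $x_1,\dots,x_n$ on which $\mathfrak S_n$ permutes the $x_i$. $T(V)=\bigoplus_{d\ge0}V^{\otimes d}$ is the tensor algebra with diagonal group action and $T(V)^{G}$ is its graded subalgebra of $G$-invariants. It is a known fact that, for a finite group $G$, $T(V)^G$ is a free associative algebra on a set of homogeneous generators (so the number of generators in each degree is well defined). The set of generators of the Cayley graph is $S=\{c_2,\dots,c_n\}$ with $c_k=(1\;k\;k-1\;\cdots\;2)$ in cycle notation. In the Cayley graph $\Gamma(G,S)$ there is a directed edge $g\to gs$ for each $g\in G$, $s\in S$. A word of length $d$ reduces to $g$ if it is a sequence $(s_1,\dots,s_d)\in S^d$ with $s_1\cdots s_d=g$. It does not cross the identity if no nonempty proper prefix reduces to the identity, i.e. $s_1\cdots s_j\ne e$ for $1\le j<d$. *)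

theory Defs
  imports Complex_Main "HOL-Algebra.Sym_Groups" "HOL-Library.Poly_Mapping"
begin

section \<open>Free associative algebras over the rationals\<close>

text \<open>The free monoid on \<open>'a\<close>, written additively, so that \<^typ>\<open>'b \<Rightarrow>\<^sub>0 rat\<close> over it becomes its
  monoid algebra, that is, the algebra of noncommutative polynomials with letters in \<open>'a\<close>.\<close>

datatype 'a fword = FWord (letters: "'a list")

instantiation fword :: (type) monoid_add
begin

definition zero_fword :: "'a fword" where "0 = FWord []"

definition plus_fword :: "'a fword \<Rightarrow> 'a fword \<Rightarrow> 'a fword"
  where "u + v = FWord (letters u @ letters v)"

instance
  by standard (auto simp: zero_fword_def plus_fword_def)

end

type_synonym 'a free_alg = "'a fword \<Rightarrow>\<^sub>0 rat"

definition scale :: "rat \<Rightarrow> 'a free_alg \<Rightarrow> 'a free_alg"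
  where "scale c f = Poly_Mapping.map ((*) c) f"

lemma scale_conv_mult: "scale c f = Poly_Mapping.single 0 c * f"
  by (simp add: scale_def mult_map_scale_conv_mult)

lemma lookup_scale [simp]: "Poly_Mapping.lookup (scale c f) w = c * Poly_Mapping.lookup f w"
  by (simp add: scale_def Poly_Mapping.map.rep_eq when_def)

interpretation free_alg: vector_space "scale :: rat \<Rightarrow> 'a free_alg \<Rightarrow> 'a free_alg"
  by standard (simp_all add: poly_mapping_eq_iff fun_eq_iff lookup_add algebra_simps)

definition var :: "'a \<Rightarrow> 'a free_alg"
  where "var a = Poly_Mapping.single (FWord [a]) 1"

text \<open>The algebra homomorphism with \<open>var a \<mapsto> \<phi> a\<close>.\<close>

definition lift_hom :: "('a \<Rightarrow> 'b free_alg) \<Rightarrow> 'a free_alg \<Rightarrow> 'b free_alg"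
  where "lift_hom \<phi> f =
    (\<Sum>w\<in>Poly_Mapping.keys f. scale (Poly_Mapping.lookup f w) (prod_list (map \<phi> (letters w))))"

text \<open>The free algebra on the set \<open>B\<close>.\<close>

definition free_alg_on :: "'a set \<Rightarrow> 'a free_alg set"
  where "free_alg_on B = {f. \<forall>w\<in>Poly_Mapping.keys f. set (letters w) \<subseteq> B}"

text \<open>\<open>A\<close> is freely generated by \<open>B \<subseteq> A\<close> as a unital associative algebra: the canonical homomorphism
  from the free algebra on \<open>B\<close> (whose letters are the elements of \<open>B\<close>) maps isomorphically onto \<open>A\<close>.\<close>

definition freely_generates :: "'a free_alg set \<Rightarrow> 'a free_alg set \<Rightarrow> bool"
  where "freely_generates B A \<longleftrightarrow> bij_betw (lift_hom (\<lambda>b. b)) (free_alg_on B) A"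


section \<open>Tensor algebra and invariants\<close>

text \<open>A vector space \<open>V\<close> is given as a space of linear forms (linear combinations of variables),
  and the tensor \<open>v\<^sub>1 \<otimes> \<dots> \<otimes> v\<^sub>d\<close> is the product \<open>v\<^sub>1 \<cdots> v\<^sub>d\<close>. Over a field, \<open>V \<subseteq> W\<close> induces an inclusion of
  tensor algebras, so this is the tensor algebra of \<open>V\<close> inside the one of the whole space of linear
  forms; see \<open>tensor_algebra_geometric_free\<close> below.\<close>

definition tensor_power :: "'a free_alg set \<Rightarrow> nat \<Rightarrow> 'a free_alg set"
  where "tensor_power V d = free_alg.span {prod_list vs |vs. length vs = d \<and> set vs \<subseteq> V}"

definition tensor_algebra :: "'a free_alg set \<Rightarrow> 'a free_alg set"
  where "tensor_algebra V = free_alg.span (\<Union>d. tensor_power V d)"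

definition geometric_basis :: "nat \<Rightarrow> nat free_alg set"
  where "geometric_basis n = {var i - var (i + 1) |i. 1 \<le> i \<and> i \<le> n - 1}"

definition geometric_module :: "nat \<Rightarrow> nat free_alg set"
  where "geometric_module n = free_alg.span (geometric_basis n)"

text \<open>The diagonal action on tensors is the action by algebra automorphisms which permutes the
  variables.\<close>

definition perm_act :: "('a \<Rightarrow> 'a) \<Rightarrow> 'a free_alg \<Rightarrow> 'a free_alg"
  where "perm_act \<sigma> = lift_hom (\<lambda>i. var (\<sigma> i))"

definition invariant_algebra :: "nat \<Rightarrow> nat free_alg set"
  where "invariant_algebra n =
    {t \<in> tensor_algebra (geometric_module n). \<forall>\<sigma>\<in>carrier (sym_group n). perm_act \<sigma> t = t}"


section \<open>Words in Cayley graphs\<close>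

text \<open>A word \<open>[s\<^sub>1, \<dots>, s\<^sub>d]\<close> with letters in \<open>S\<close> labels the walk \<open>e \<rightarrow> s\<^sub>1 \<rightarrow> s\<^sub>1 s\<^sub>2 \<rightarrow> \<dots>\<close> in the Cayley graph.\<close>

definition cayley_words :: "'g set \<Rightarrow> nat \<Rightarrow> 'g list set"
  where "cayley_words S d = {w. length w = d \<and> set w \<subseteq> S}"

definition reduces_to :: "('g, 'm) monoid_scheme \<Rightarrow> 'g list \<Rightarrow> 'g \<Rightarrow> bool"
  where "reduces_to G w g \<longleftrightarrow> foldr (\<otimes>\<^bsub>G\<^esub>) w \<one>\<^bsub>G\<^esub> = g"

definition crosses_identity :: "('g, 'm) monoid_scheme \<Rightarrow> 'g list \<Rightarrow> bool"
  where "crosses_identity G w \<longleftrightarrow> (\<exists>j. 1 \<le> j \<and> j < length w \<and> reduces_to G (take j w) \<one>\<^bsub>G\<^esub>)"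

text \<open>The cycle \<open>(1 k k-1 \<cdots> 2)\<close>. The product of \<^const>\<open>sym_group\<close> is composition of functions, the right
  factor being applied first.\<close>

definition cayley_cycle :: "nat \<Rightarrow> nat \<Rightarrow> nat"
  where "cayley_cycle k = cycle_of_list (1 # rev [2..<k + 1])"

definition cayley_gens :: "nat \<Rightarrow> (nat \<Rightarrow> nat) set"
  where "cayley_gens n = cayley_cycle ` {2..n}"


section \<open>The tensor algebra of the geometric module is free on a basis of the module\<close>

lemma sum_singles: "(\<Sum>w\<in>Poly_Mapping.keys f. Poly_Mapping.single w (Poly_Mapping.lookup f w)) = f"
proof (rule poly_mapping_eqI)
  fix k
  have "(\<Sum>w\<in>Poly_Mapping.keys f. Poly_Mapping.lookup f w when w = k) = Poly_Mapping.lookup f k"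
    by (cases "k \<in> Poly_Mapping.keys f")
      (simp_all add: when_def sum.If_cases in_keys_iff Int_def sum.delta')
  then show "Poly_Mapping.lookup (\<Sum>w\<in>Poly_Mapping.keys f. Poly_Mapping.single w (Poly_Mapping.lookup f w)) k
      = Poly_Mapping.lookup f k"
    by (simp add: lookup_sum lookup_single)
qed

lemma lift_hom_superset:
  assumes "finite A" "Poly_Mapping.keys f \<subseteq> A"
  shows "lift_hom \<phi> f = (\<Sum>w\<in>A. scale (Poly_Mapping.lookup f w) (prod_list (map \<phi> (letters w))))"
  unfolding lift_hom_def using assms
  by (intro sum.mono_neutral_left) (auto simp: in_keys_iff)

lemma lift_hom_add: "lift_hom \<phi> (f + g) = lift_hom \<phi> f + lift_hom \<phi> g"
proof -
  let ?A = "Poly_Mapping.keys f \<union> Poly_Mapping.keys g"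
  have "Poly_Mapping.keys (f + g) \<subseteq> ?A" by (rule Poly_Mapping.keys_add)
  then show ?thesis
    by (simp add: lift_hom_superset[of ?A] lookup_add free_alg.scale_left_distrib sum.distrib)
qed

lemma lift_hom_scale: "lift_hom \<phi> (scale c f) = scale c (lift_hom \<phi> f)"
proof -
  have "Poly_Mapping.keys (scale c f) \<subseteq> Poly_Mapping.keys f" by (auto simp: in_keys_iff)
  then have "lift_hom \<phi> (scale c f) = (\<Sum>w\<in>Poly_Mapping.keys f.
      scale (Poly_Mapping.lookup (scale c f) w) (prod_list (map \<phi> (letters w))))"
    by (intro lift_hom_superset) auto
  then show ?thesis
    by (simp add: lift_hom_def free_alg.scale_sum_right)
qed

lemma lift_hom_single:
  "lift_hom \<phi> (Poly_Mapping.single w c) = scale c (prod_list (map \<phi> (letters w)))"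
  by (subst lift_hom_superset[of "{w}"]) auto

lemma lift_hom_0: "lift_hom \<phi> 0 = 0" by (simp add: lift_hom_def)

lemma lift_hom_sum: "lift_hom \<phi> (sum F A) = (\<Sum>a\<in>A. lift_hom \<phi> (F a))"
  by (induction A rule: infinite_finite_induct) (auto simp: lift_hom_0 lift_hom_add)

lemma lift_hom_var: "lift_hom \<phi> (var a) = \<phi> a"
  by (simp add: var_def lift_hom_single)

lemma scale_mult_left: "scale c f * g = scale c (f * g)"
  by (simp add: scale_conv_mult mult.assoc)

lemma single0_comm: "f * Poly_Mapping.single 0 c = Poly_Mapping.single 0 c * (f :: 'a free_alg)"
proof -
  have "(\<Sum>w\<in>Poly_Mapping.keys f. Poly_Mapping.single w (Poly_Mapping.lookup f w)) * Poly_Mapping.single 0 c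
    = Poly_Mapping.single 0 c * (\<Sum>w\<in>Poly_Mapping.keys f. Poly_Mapping.single w (Poly_Mapping.lookup f w))"
    by (simp add: sum_distrib_left sum_distrib_right mult_single mult.commute)
  then show ?thesis by (simp add: sum_singles)
qed

lemma scale_mult_right: "f * scale c g = scale c (f * g)"
  by (metis scale_conv_mult mult.assoc single0_comm)

lemma lift_hom_mult: "lift_hom \<phi> (f * g) = lift_hom \<phi> f * lift_hom \<phi> g"
proof -
  have "lift_hom \<phi> (Poly_Mapping.single u a * Poly_Mapping.single v b) =
     lift_hom \<phi> (Poly_Mapping.single u a) * lift_hom \<phi> (Poly_Mapping.single v b)" for u v a b
    by (simp add: mult_single lift_hom_single plus_fword_def scale_mult_left scale_mult_right mult.commute)
  then have "lift_hom \<phi> ((\<Sum>u\<in>Poly_Mapping.keys f. Poly_Mapping.single u (Poly_Mapping.lookup f u)) *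
      (\<Sum>u\<in>Poly_Mapping.keys g. Poly_Mapping.single u (Poly_Mapping.lookup g u))) =
     lift_hom \<phi> (\<Sum>u\<in>Poly_Mapping.keys f. Poly_Mapping.single u (Poly_Mapping.lookup f u)) *
     lift_hom \<phi> (\<Sum>u\<in>Poly_Mapping.keys g. Poly_Mapping.single u (Poly_Mapping.lookup g u))"
    by (simp add: sum_product lift_hom_sum)
  then show ?thesis by (simp add: sum_singles)
qed

lemma lift_hom_1: "lift_hom \<phi> 1 = 1"
proof -
  have "lift_hom \<phi> 1 = lift_hom \<phi> (Poly_Mapping.single 0 1)"
    by (simp only: single_one)
  also have "\<dots> = 1"
    unfolding lift_hom_single by (simp add: zero_fword_def)
  finally show ?thesis .
qed

lemma lift_hom_prod_list: "lift_hom \<phi> (prod_list fs) = prod_list (map (lift_hom \<phi>) fs)"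
  by (induction fs) (auto simp: lift_hom_1 lift_hom_mult)

lemma lift_hom_comp: "lift_hom \<psi> (lift_hom \<phi> f) = lift_hom (\<lambda>a. lift_hom \<psi> (\<phi> a)) f"
  by (simp add: lift_hom_def[of _ f] lift_hom_sum lift_hom_scale lift_hom_prod_list comp_def)

lemma prod_list_var: "prod_list (map var xs) = Poly_Mapping.single (FWord xs) 1"
proof (induction xs)
  case Nil
  then show ?case by (metis list.map(1) prod_list.Nil single_one zero_fword_def)
next
  case (Cons a xs)
  then show ?case by (simp add: var_def mult_single plus_fword_def)
qed

lemma lift_hom_id:
  assumes "f \<in> free_alg_on B" "\<And>b. b \<in> B \<Longrightarrow> \<phi> b = var b"
  shows "lift_hom \<phi> f = f"
proof -
  have "scale c (prod_list (map \<phi> (letters w))) = Poly_Mapping.single w c"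
    if "w \<in> Poly_Mapping.keys f" for w c
  proof -
    have "map \<phi> (letters w) = map var (letters w)"
      using assms that by (auto simp: free_alg_on_def)
    then have "prod_list (map \<phi> (letters w)) = Poly_Mapping.single w 1"
      by (simp only: prod_list_var fword.collapse)
    then show ?thesis
      by (simp add: scale_conv_mult mult_single)
  qed
  then show ?thesis by (simp add: lift_hom_def sum_singles)
qed

lemma free_subspace: "free_alg.subspace (free_alg_on B)"
proof -
  have "f + g \<in> free_alg_on B" if "f \<in> free_alg_on B" "g \<in> free_alg_on B" for f g
    using that Poly_Mapping.keys_add[of f g] unfolding free_alg_on_def by blast
  moreover have "scale c f \<in> free_alg_on B" if "f \<in> free_alg_on B" for c f
    using that by (simp add: free_alg_on_def in_keys_iff)
  moreover have "0 \<in> free_alg_on B"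
    by (simp add: free_alg_on_def)
  ultimately show ?thesis
    unfolding free_alg.subspace_def by blast
qed

lemma tensor_algebra_geometric_free:
  "freely_generates (geometric_basis n) (tensor_algebra (geometric_module n))"
  unfolding freely_generates_def
proof (rule bij_betw_imageI)
  let ?ev = "lift_hom (\<lambda>b. b :: nat free_alg)"
  let ?V = "geometric_module n"
  let ?I = "?ev ` free_alg_on (geometric_basis n)"
  define \<psi> :: "nat \<Rightarrow> nat free_alg free_alg"
    where "\<psi> i = (\<Sum>j\<in>{i..<n}. var (var j - var (j + 1)))" for i
  have psi: "lift_hom \<psi> b = var b" if "b \<in> geometric_basis n" for b
  proof -
    obtain i where i: "b = var i - var (i + 1)" "i < n" using \<open>b \<in> geometric_basis n\<close> by (auto simp: geometric_basis_def)
    have "lift_hom \<psi> (b + var (i+1)) = lift_hom \<psi> b + \<psi> (i+1)"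
      by (simp only: lift_hom_add lift_hom_var)
    then have "\<psi> i = lift_hom \<psi> b + \<psi> (i + 1)" by (simp add: i lift_hom_var)
    moreover have "\<psi> i = var b + \<psi> (i + 1)"
      unfolding \<psi>_def i(1) using i(2) by (simp add: sum.atLeast_Suc_lessThan)
    ultimately show ?thesis by simp
  qed
  show "inj_on ?ev (free_alg_on (geometric_basis n))"
  proof (rule inj_on_inverseI)
    fix f assume "f \<in> free_alg_on (geometric_basis n)"
    then show "lift_hom \<psi> (?ev f) = f"
      unfolding lift_hom_comp using psi by (intro lift_hom_id) auto
  qed
  have basis_V: "geometric_basis n \<subseteq> ?V"
    by (auto simp: geometric_basis_def geometric_module_def intro: free_alg.span_base)
  have sub: "free_alg.subspace ?I"
    unfolding free_alg.subspace_def
  proof safe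
    show "0 \<in> ?I" using free_subspace[of "geometric_basis n"] lift_hom_0 by (metis free_alg.subspace_0 imageI)
    fix f g c assume *: "f \<in> free_alg_on (geometric_basis n)" "g \<in> free_alg_on (geometric_basis n)"
    show "?ev f + ?ev g \<in> ?I"
      using * free_subspace by (metis lift_hom_add free_alg.subspace_add imageI)
    show "scale c (?ev f) \<in> ?I"
      using * free_subspace by (metis lift_hom_scale free_alg.subspace_scale imageI)
  qed
  have V_I: "?V \<subseteq> ?I"
    unfolding geometric_module_def
  proof (rule free_alg.span_minimal[OF _ sub], rule)
    fix b assume "b \<in> geometric_basis n"
    then have "var b \<in> free_alg_on (geometric_basis n)" by (auto simp: free_alg_on_def var_def)
    then show "b \<in> ?I" by (metis lift_hom_var imageI)
  qed
  have mult_I: "x * y \<in> ?I" if xy: "x \<in> ?I" "y \<in> ?I" for x y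
  proof -
    obtain f g where fg: "f \<in> free_alg_on (geometric_basis n)" "g \<in> free_alg_on (geometric_basis n)" "x = ?ev f" "y = ?ev g"
      using xy by auto
    have "f * g \<in> free_alg_on (geometric_basis n)"
      using fg(1,2) Poly_Mapping.keys_mult[of f g] by (fastforce simp: free_alg_on_def plus_fword_def)
    then show ?thesis using fg by (metis lift_hom_mult imageI)
  qed
  have one_I: "1 \<in> ?I"
  proof -
    have "1 \<in> free_alg_on (geometric_basis n)" by (auto simp: free_alg_on_def zero_fword_def)
    then show ?thesis by (metis lift_hom_1 imageI)
  qed
  have prod_I: "prod_list vs \<in> ?I" if "set vs \<subseteq> ?V" for vs
    using that by (induction vs) (use one_I mult_I V_I in auto)
  show "?I = tensor_algebra ?V"
  proof
    show "tensor_algebra ?V \<subseteq> ?I"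
      unfolding tensor_algebra_def
    proof (rule free_alg.span_minimal[OF _ sub], rule UN_least)
      fix d show "tensor_power ?V d \<subseteq> ?I"
        unfolding tensor_power_def
        by (rule free_alg.span_minimal[OF _ sub]) (use prod_I in auto)
    qed
    show "?I \<subseteq> tensor_algebra ?V"
    proof
      fix x assume "x \<in> ?I"
      then obtain f where f: "f \<in> free_alg_on (geometric_basis n)" "x = ?ev f" by auto
      have "prod_list (letters w) \<in> tensor_algebra ?V" if "w \<in> Poly_Mapping.keys f" for w
      proof -
        have "set (letters w) \<subseteq> ?V" using f(1) that basis_V by (auto simp: free_alg_on_def)
        then have "prod_list (letters w) \<in> tensor_power ?V (length (letters w))"
          unfolding tensor_power_def by (auto intro: free_alg.span_base)
        then show ?thesis unfolding tensor_algebra_def by (auto intro: free_alg.span_base)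
      qed
      then show "x \<in> tensor_algebra ?V"
        unfolding f(2) lift_hom_def tensor_algebra_def
        by (auto intro!: free_alg.span_sum free_alg.span_scale)
    qed
  qed
qed

end

theory Submission
  imports Defs
begin

text \<open>Let \<open>V\<close> be the geometric module and \<open>h d\<close> the dimension of the invariants in its \<open>d\<close>-th tensor
  power. If \<open>a k\<close> generators have degree \<open>k\<close>, then the words in the generators form a basis of the
  invariants, and splitting off the first letter gives \<open>h d = (\<Sum>k=1..d. a k * h (d - k))\<close>.
  The closed walks of length \<open>d\<close> in a Cayley graph satisfy
  the same recursion, with \<open>a k\<close> replaced by the number of closed walks of length \<open>k\<close> which do not cross
  the identity: cut at the first return. Since such a recursion determines \<open>a\<close> from \<open>h\<close>
  (\<open>renewal_unique\<close>), it suffices to show that \<open>h d\<close> is the number of closed words of length \<open>d\<close>.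

  To compare these two numbers, replace \<open>V\<close> by the whole permutation module \<open>M = V \<oplus> \<rat>\<close>, and
  simultaneously allow the identity \<open>c\<^sub>1\<close> as an additional letter of the words. Let \<open>F(a,b)\<close> be the
  dimension of the invariants of \<open>M\<^sup>\<otimes>\<^sup>a \<otimes> V\<^sup>\<otimes>\<^sup>b\<close>, and \<open>G(a,b)\<close> the number of words of length \<open>a + b\<close> in
  \<open>c\<^sub>1, \<dots>, c\<^sub>n\<close> with product the identity in which \<open>c\<^sub>1\<close> occurs only among the first \<open>a\<close> letters.
  Splitting one factor \<open>M\<close> on the one side, and deciding whether one letter is \<open>c\<^sub>1\<close> on the other side,
  shows that both satisfy \<open>F(a+1,b) = F(a,b+1) + F(a,b)\<close>; see \<open>has_dim_mixed_invariants_step\<close> and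
  \<open>card_closed_words_step\<close>. Hence \<open>F = G\<close> follows from \<open>F(d,0) = G(d,0)\<close>, and \<open>F(0,d) = G(0,d)\<close> is the
  required equality.

  For \<open>b = 0\<close> both sides count the orbits of \<open>\<SS>\<^sub>n\<close> on words of length \<open>d\<close> over \<open>{1..n}\<close>. The invariants
  of \<open>M\<^sup>\<otimes>\<^sup>d\<close> have the orbit sums as a basis. On the other hand, right multiplication by \<open>c\<^sub>k\<close> moves the
  \<open>k\<close>-th entry of the one-line notation to the front, so a word in the \<open>c\<^sub>k\<close> is the same as the word of
  the labels which are moved, and the final arrangement lists the labels by the time of their last move,
  the latest first, followed by the labels which never moved. It is the identity if and only if
  the labels ordered in this way are \<open>1, \<dots>, m\<close>, and every orbit contains exactly one such word.\<close>

section \<open>Linear maps given on words\<close>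

definition linear_extension :: "('a fword \<Rightarrow> 'b free_alg) \<Rightarrow> 'a free_alg \<Rightarrow> 'b free_alg"
  where "linear_extension h f = (\<Sum>w\<in>Poly_Mapping.keys f. scale (Poly_Mapping.lookup f w) (h w))"

lemma linear_extension_superset:
  assumes "finite A" "Poly_Mapping.keys f \<subseteq> A"
  shows "linear_extension h f = (\<Sum>w\<in>A. scale (Poly_Mapping.lookup f w) (h w))"
  unfolding linear_extension_def using assms
  by (intro sum.mono_neutral_left) (auto simp: in_keys_iff)

lemma linear_extension_add: "linear_extension h (f + g) = linear_extension h f + linear_extension h g"
proof -
  let ?A = "Poly_Mapping.keys f \<union> Poly_Mapping.keys g"
  have "Poly_Mapping.keys (f + g) \<subseteq> ?A" by (rule Poly_Mapping.keys_add)
  then show ?thesis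
    by (simp add: linear_extension_superset[of ?A] lookup_add free_alg.scale_left_distrib sum.distrib)
qed

lemma linear_extension_scale: "linear_extension h (scale c f) = scale c (linear_extension h f)"
proof -
  have "Poly_Mapping.keys (scale c f) \<subseteq> Poly_Mapping.keys f" by (auto simp: in_keys_iff)
  then show ?thesis
    by (simp add: linear_extension_superset[of "Poly_Mapping.keys f"] free_alg.scale_sum_right)
qed

lemma linear_linear_extension: "Vector_Spaces.linear scale scale (linear_extension h)"
  by unfold_locales (simp_all add: linear_extension_add linear_extension_scale)

lemma linear_extension_0 [simp]: "linear_extension h 0 = 0"
  by (simp add: linear_extension_def)

lemma linear_extension_diff: "linear_extension h (f - g) = linear_extension h f - linear_extension h g"
  by (metis diff_add_cancel add_diff_cancel_right' linear_extension_add)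

lemma linear_extension_sum: "linear_extension h (sum F A) = (\<Sum>a\<in>A. linear_extension h (F a))"
  by (induction A rule: infinite_finite_induct) (auto simp: linear_extension_add)

lemma linear_extension_single [simp]: "linear_extension h (Poly_Mapping.single w c) = scale c (h w)"
  by (subst linear_extension_superset[of "{w}"]) auto

lemma linear_extension_comp: "linear_extension h (linear_extension k f) =
    linear_extension (\<lambda>w. linear_extension h (k w)) f"
  by (simp add: linear_extension_def[of _ f] linear_extension_sum linear_extension_scale)

lemma linear_extension_cong:
  assumes "\<And>w. w \<in> Poly_Mapping.keys f \<Longrightarrow> h w = k w"
  shows "linear_extension h f = linear_extension k f"
  using assms by (simp add: linear_extension_def)

lemma scale_single [simp]: "scale c (Poly_Mapping.single w a) = Poly_Mapping.single w (c * a)"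
  by (simp add: scale_conv_mult mult_single)

lemma linear_extension_monomials: "linear_extension (\<lambda>w. Poly_Mapping.single w 1) f = f"
  by (simp add: linear_extension_def sum_singles)

lemma linear_extension_minus_fun:
  "linear_extension (\<lambda>w. h w - k w) f = linear_extension h f - linear_extension k f"
  by (simp add: linear_extension_def free_alg.scale_right_diff_distrib sum_subtractf)

lemma lift_hom_linear_extension: "lift_hom \<phi> f = linear_extension (\<lambda>w. prod_list (map \<phi> (letters w))) f"
  by (simp add: lift_hom_def linear_extension_def)

text \<open>Products are determined by the products of the words that occur, so it suffices that \<open>h\<close> splits on those
  words; for contractions it does so only for words of a fixed length.\<close>
lemma linear_extension_mult:
  assumes "\<And>u v. u \<in> Poly_Mapping.keys f \<Longrightarrow> v \<in> Poly_Mapping.keys g \<Longrightarrow> h (u + v) = k u * l v"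
  shows "linear_extension h (f * g) = linear_extension k f * linear_extension l g"
proof -
  have "f * g = (\<Sum>u\<in>Poly_Mapping.keys f. \<Sum>v\<in>Poly_Mapping.keys g.
      Poly_Mapping.single (u + v) (Poly_Mapping.lookup f u * Poly_Mapping.lookup g v))"
    by (subst sum_singles[of f, symmetric], subst sum_singles[of g, symmetric])
      (simp add: sum_product mult_single)
  also have "linear_extension h \<dots> = (\<Sum>u\<in>Poly_Mapping.keys f. \<Sum>v\<in>Poly_Mapping.keys g.
      scale (Poly_Mapping.lookup f u) (k u) * scale (Poly_Mapping.lookup g v) (l v))"
    by (simp add: linear_extension_sum assms scale_mult_left scale_mult_right mult.commute)
  also have "\<dots> = linear_extension k f * linear_extension l g"
    by (simp add: linear_extension_def sum_product)
  finally show ?thesis .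
qed

lemma perm_act_linear_extension:
  "perm_act \<sigma> f = linear_extension (\<lambda>w. Poly_Mapping.single (FWord (map \<sigma> (letters w))) 1) f"
  unfolding perm_act_def lift_hom_linear_extension
  by (simp add: comp_def flip: prod_list_var)

lemma keys_linear_extension:
  "Poly_Mapping.keys (linear_extension h f) \<subseteq> (\<Union>w\<in>Poly_Mapping.keys f. Poly_Mapping.keys (h w))"
proof
  fix v assume "v \<in> Poly_Mapping.keys (linear_extension h f)"
  then have "(\<Sum>w\<in>Poly_Mapping.keys f. Poly_Mapping.lookup f w * Poly_Mapping.lookup (h w) v) \<noteq> 0"
    by (simp add: linear_extension_def in_keys_iff lookup_sum)
  then obtain w where "w \<in> Poly_Mapping.keys f" "Poly_Mapping.lookup (h w) v \<noteq> 0"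
    by (auto elim: sum.not_neutral_contains_not_neutral)
  then show "v \<in> (\<Union>w\<in>Poly_Mapping.keys f. Poly_Mapping.keys (h w))"
    by (auto simp: in_keys_iff)
qed

section \<open>Dimensions of subspaces\<close>

text \<open>In contrast to \<open>free_alg.dim\<close>, which is \<open>0\<close> for spaces of infinite dimension, this includes
  finiteness.\<close>
definition has_dim :: "'a free_alg set \<Rightarrow> nat \<Rightarrow> bool"
  where "has_dim S k \<longleftrightarrow> (\<exists>B. finite B \<and> card B = k \<and> free_alg.independent B \<and> free_alg.span B = S)"

lemma has_dim_unique: "has_dim S k \<Longrightarrow> has_dim S l \<Longrightarrow> k = l"
  unfolding has_dim_def by (metis free_alg.dim_eq_card_independent free_alg.dim_span)

lemma has_dim_subspace:
  assumes "has_dim S k" "free_alg.subspace K" "K \<subseteq> S"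
  obtains l where "has_dim K l"
proof -
  obtain A where A: "finite A" "free_alg.span A = S"
    using assms(1) by (auto simp: has_dim_def)
  obtain B where B: "B \<subseteq> K" "free_alg.independent B" "K \<subseteq> free_alg.span B"
    by (rule free_alg.basis_exists)
  have "finite B"
    using free_alg.independent_span_bound[of A B] A B assms(3) by blast
  moreover have "free_alg.span B = K"
    using B free_alg.span_minimal[OF B(1) assms(2)] by (intro subset_antisym)
  ultimately show ?thesis
    using that B(2) unfolding has_dim_def by blast
qed

text \<open>The coefficients at the words \<open>x j\<close> act as dual functionals.\<close>
lemma independent_dual_family:
  assumes dual: "\<And>i j. i \<in> I \<Longrightarrow> j \<in> I \<Longrightarrow> Poly_Mapping.lookup (e i) (x j) = (if i = j then 1 else 0)"
  shows "inj_on e I" "free_alg.independent (e ` I)"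
proof -
  show inj: "inj_on e I"
  proof (rule inj_onI)
    fix i j assume "i \<in> I" "j \<in> I" "e i = e j"
    then show "i = j"
      using dual[of i j] dual[of j j] by (auto split: if_splits)
  qed
  show "free_alg.independent (e ` I)"
    unfolding free_alg.independent_explicit_finite_subsets
  proof (intro allI impI ballI)
    fix S c b assume S: "S \<subseteq> e ` I" "finite S" and sum: "(\<Sum>b\<in>S. scale (c b) b) = 0" and b: "b \<in> S"
    then obtain j where j: "j \<in> I" "b = e j" by auto
    have "0 = Poly_Mapping.lookup (\<Sum>b\<in>S. scale (c b) b) (x j)"
      by (simp add: sum)
    also have "\<dots> = (\<Sum>v\<in>S. if v = b then c v else 0)"
      unfolding lookup_sum
    proof (rule sum.cong)
      fix v assume "v \<in> S"
      then obtain i where "i \<in> I" "v = e i" using S by auto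
      then show "Poly_Mapping.lookup (scale (c v) v) (x j) = (if v = b then c v else 0)"
        using j dual inj by (auto simp: inj_on_eq_iff)
    qed simp
    also have "\<dots> = c b"
      using b S(2) by simp
    finally show "c b = 0" by simp
  qed
qed

text \<open>The map \<open>s\<close> splits \<open>p\<close>, so \<open>S\<close> is the direct sum of the kernel of \<open>p\<close> and of \<open>s ` T\<close>; bases of
  the summands are put together to a basis of \<open>S\<close>.\<close>
lemma has_dim_kernel_split_epi:
  fixes p :: "'a free_alg \<Rightarrow> 'b free_alg"
  assumes p: "Vector_Spaces.linear scale scale p" and s: "Vector_Spaces.linear scale scale s"
    and dim: "has_dim S m" "has_dim T t"
    and maps: "\<And>x. x \<in> S \<Longrightarrow> p x \<in> T" "\<And>y. y \<in> T \<Longrightarrow> s y \<in> S"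
    and retract: "\<And>y. y \<in> T \<Longrightarrow> p (s y) = y"
  shows "\<exists>k. has_dim {x \<in> S. p x = 0} k \<and> m = k + t"
proof -
  interpret p: Vector_Spaces.linear scale scale p by (fact p)
  interpret s: Vector_Spaces.linear scale scale s by (fact s)
  let ?K = "{x \<in> S. p x = 0}"
  obtain A where A: "finite A" "card A = m" "free_alg.span A = S"
    using dim(1) by (auto simp: has_dim_def)
  obtain C where C: "finite C" "card C = t" "free_alg.independent C" "free_alg.span C = T"
    using dim(2) by (auto simp: has_dim_def)
  have S: "free_alg.subspace S" and T: "free_alg.subspace T"
    using A C by auto
  have K: "free_alg.subspace ?K"
    using S by (auto simp: free_alg.subspace_def p.add p.scale)
  then obtain k where "has_dim ?K k"
    using has_dim_subspace[OF dim(1)] by blast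
  then obtain B where B: "finite B" "card B = k" "free_alg.independent B" "free_alg.span B = ?K"
    by (auto simp: has_dim_def)
  have BK: "p b = 0" if "b \<in> B" for b
    using that B(4) free_alg.span_base by blast
  have CT: "c \<in> T" if "c \<in> C" for c
    using that C(4) free_alg.span_base by blast
  have inj: "inj_on s T"
    using retract by (metis inj_on_inverseI)
  have inj_C: "inj_on s C"
    using inj CT by (meson inj_on_subset subsetI)
  have disj: "B \<inter> s ` C = {}"
  proof -
    have False if "c \<in> C" "s c \<in> B" for c
    proof -
      have "c = 0" using that BK retract CT by metis
      then show False using that C(3) free_alg.dependent_zero by blast
    qed
    then show ?thesis by auto
  qed
  have "free_alg.independent (B \<union> s ` C)"
  proof (rule free_alg.independent_if_scalars_zero)
    show "finite (B \<union> s ` C)" using B C by simp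
    fix c x assume sum: "(\<Sum>x\<in>B \<union> s ` C. scale (c x) x) = 0" and x: "x \<in> B \<union> s ` C"
    have split: "(\<Sum>x\<in>B \<union> s ` C. scale (c x) x) = (\<Sum>b\<in>B. scale (c b) b) + (\<Sum>y\<in>C. scale (c (s y)) (s y))"
      using B C disj by (simp add: sum.union_disjoint sum.reindex[OF inj_C])
    have "p (\<Sum>x\<in>B \<union> s ` C. scale (c x) x) = (\<Sum>y\<in>C. scale (c (s y)) y)"
      unfolding split by (simp add: p.add p.sum p.scale BK retract CT)
    then have "(\<Sum>y\<in>C. scale (c (s y)) y) = 0"
      by (simp add: sum p.zero)
    then have c0: "c (s y) = 0" if "y \<in> C" for y
      using free_alg.independentD[OF C(3,1) subset_refl, of "\<lambda>y. c (s y)"] that by auto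
    then have "(\<Sum>b\<in>B. scale (c b) b) = 0"
      using split sum by simp
    then have "c b = 0" if "b \<in> B" for b
      using free_alg.independentD[OF B(3,1) subset_refl, of c] that by auto
    then show "c x = 0" using x c0 by auto
  qed
  moreover have "free_alg.span (B \<union> s ` C) = S"
  proof
    have "B \<union> s ` C \<subseteq> S"
      using B(4) maps(2) CT free_alg.span_superset[of B] by auto
    then show "free_alg.span (B \<union> s ` C) \<subseteq> S"
      using S by (rule free_alg.span_minimal)
    show "S \<subseteq> free_alg.span (B \<union> s ` C)"
    proof
      fix x assume x: "x \<in> S"
      have "x - s (p x) \<in> ?K"
        using x maps retract S by (simp add: p.diff free_alg.subspace_diff)
      moreover have "s (p x) \<in> free_alg.span (s ` C)"
        using x maps(1) C(4) by (simp add: s.span_image)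
      ultimately show "x \<in> free_alg.span (B \<union> s ` C)"
        unfolding free_alg.span_Un B(4)
        by (intro CollectI exI[of _ "x - s (p x)"] exI[of _ "s (p x)"]) auto
    qed
  qed
  ultimately have "has_dim S (k + t)"
    unfolding has_dim_def using B(1,2) C(1,2) disj inj_C
    by (intro exI[of _ "B \<union> s ` C"]) (simp add: card_Un_disjoint card_image)
  then show ?thesis
    using has_dim_unique[OF dim(1)] \<open>has_dim ?K k\<close> by blast
qed

section \<open>Contractions and the mixed tensor powers\<close>

definition words :: "nat \<Rightarrow> nat \<Rightarrow> nat fword set"
  where "words n d = {w. length (letters w) = d \<and> set (letters w) \<subseteq> {1..n}}"

definition delete_letter :: "nat \<Rightarrow> 'a fword \<Rightarrow> 'a fword"
  where "delete_letter j w = FWord (take j (letters w) @ drop (Suc j) (letters w))"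

text \<open>Applies the functional \<open>x\<^sub>i \<mapsto> 1\<close> of the permutation module to the tensor factor number \<open>j\<close>, counted
  from \<open>0\<close>. Its kernel on the permutation module is the geometric module.\<close>
definition contract :: "nat \<Rightarrow> 'a free_alg \<Rightarrow> 'a free_alg"
  where "contract j = linear_extension (\<lambda>w. Poly_Mapping.single (delete_letter j w) 1)"

definition insert_letter :: "nat \<Rightarrow> 'a \<Rightarrow> 'a fword \<Rightarrow> 'a fword"
  where "insert_letter j x w = FWord (take j (letters w) @ x # drop j (letters w))"

text \<open>Inserts the vector \<open>(x\<^sub>1 + \<dots> + x\<^sub>n) / n\<close> as the tensor factor number \<open>j\<close>: an invariant section of
  the contraction.\<close>
definition insert_mean :: "nat \<Rightarrow> nat \<Rightarrow> nat free_alg \<Rightarrow> nat free_alg"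
  where "insert_mean n j =
    linear_extension (\<lambda>w. \<Sum>x\<in>{1..n}. Poly_Mapping.single (insert_letter j x w) (1 / of_nat n))"

text \<open>The invariants of \<open>M\<^sup>\<otimes>\<^sup>a \<otimes> V\<^sup>\<otimes>\<^sup>b\<close>, where \<open>M\<close> is the permutation module and \<open>V\<close> the geometric module. That
  the last factors lie in \<open>V\<close> is expressed by the vanishing of their contractions.\<close>
definition mixed_invariants :: "nat \<Rightarrow> nat \<Rightarrow> nat \<Rightarrow> nat free_alg set"
  where "mixed_invariants n a b = {f. Poly_Mapping.keys f \<subseteq> words n (a + b) \<and>
    (\<forall>j\<in>{a..<a + b}. contract j f = 0) \<and> (\<forall>\<sigma>\<in>carrier (sym_group n). perm_act \<sigma> f = f)}"

lemma subspace_keys: "free_alg.subspace {f. Poly_Mapping.keys f \<subseteq> W}"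
  unfolding free_alg.subspace_def
  by (auto simp: in_keys_iff lookup_add) (metis add.right_neutral in_keys_iff subsetD)

lemma subspace_mixed_invariants: "free_alg.subspace (mixed_invariants n a b)"
  using subspace_keys[of "words n (a + b)"]
  by (auto simp: mixed_invariants_def free_alg.subspace_def contract_def perm_act_linear_extension linear_extension_add linear_extension_scale)

lemma delete_delete: "a \<le> j \<Longrightarrow> delete_letter j (delete_letter a w) = delete_letter a (delete_letter (Suc j) w)"
proof -
  assume "a \<le> j"
  then have "take j (take a xs @ drop (Suc a) xs) @ drop (Suc j) (take a xs @ drop (Suc a) xs) =
    take a (take (Suc j) xs @ drop (Suc (Suc j)) xs) @ drop (Suc a) (take (Suc j) xs @ drop (Suc (Suc j)) xs)"
    for xs :: "'a list"
  proof (induction xs arbitrary: a j)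
    case Nil
    then show ?case by simp
  next
    case (Cons x xs)
    then show ?case by (cases a; cases j) auto
  qed
  then show ?thesis by (simp add: delete_letter_def)
qed

lemma contract_contract: "a \<le> j \<Longrightarrow> contract j (contract a f) = contract a (contract (Suc j) f)"
  by (simp add: contract_def linear_extension_comp delete_delete)

lemma delete_insert_same: "a \<le> length (letters w) \<Longrightarrow> delete_letter a (insert_letter a x w) = w"
  by (simp add: delete_letter_def insert_letter_def)

lemma delete_insert_later:
  assumes "a \<le> j" "a \<le> length (letters w)"
  shows "delete_letter (Suc j) (insert_letter a x w) = insert_letter a x (delete_letter j w)"
proof -
  have "take (Suc j) (take a xs @ x # drop a xs) @ drop (Suc (Suc j)) (take a xs @ x # drop a xs) =
     take a (take j xs @ drop (Suc j) xs) @ x # drop a (take j xs @ drop (Suc j) xs)"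
    if "a \<le> j" "a \<le> length xs" for xs :: "'a list"
    using that
  proof (induction xs arbitrary: a j)
    case Nil
    then show ?case by simp
  next
    case (Cons y ys)
    then show ?case by (cases a; cases j) auto
  qed
  from this[OF assms] show ?thesis by (simp add: delete_letter_def insert_letter_def)
qed

text \<open>The functional takes the value \<open>1\<close> on the mean of the variables.\<close>
lemma contract_insert_mean_same:
  assumes "n \<ge> 1" "\<And>w. w \<in> Poly_Mapping.keys f \<Longrightarrow> a \<le> length (letters w)"
  shows "contract a (insert_mean n a f) = f"
proof -
  have mean: "(\<Sum>x\<in>{1..n}. Poly_Mapping.single w (1 / of_nat n)) = Poly_Mapping.single w (1 :: rat)"
    for w :: "nat fword"
  proof -
    have "(\<Sum>x\<in>A. Poly_Mapping.single w c) = Poly_Mapping.single w (of_nat (card A) * c)"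
      if "finite A" for A :: "nat set" and c :: rat
      using that by (induction A rule: finite_induct) (simp_all add: single_add distrib_right flip: single_add)
    from this[of "{1..n}" "1 / of_nat n"] show ?thesis
      using assms(1) by (simp del: sum_constant)
  qed
  have "contract a (insert_mean n a f) = linear_extension (\<lambda>w. Poly_Mapping.single w 1) f"
    unfolding contract_def insert_mean_def linear_extension_comp
  proof (rule linear_extension_cong)
    fix w assume "w \<in> Poly_Mapping.keys f"
    then show "linear_extension (\<lambda>w. Poly_Mapping.single (delete_letter a w) 1)
        (\<Sum>x\<in>{1..n}. Poly_Mapping.single (insert_letter a x w) (1 / of_nat n)) = Poly_Mapping.single w 1"
      using mean[of w] assms(2)[of w] by (simp add: linear_extension_sum delete_insert_same del: sum_constant)
  qed
  then show ?thesis by (simp add: linear_extension_monomials)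
qed

lemma contract_insert_mean_later:
  assumes "a \<le> j" "\<And>w. w \<in> Poly_Mapping.keys f \<Longrightarrow> a \<le> length (letters w)"
  shows "contract (Suc j) (insert_mean n a f) = insert_mean n a (contract j f)"
  unfolding contract_def insert_mean_def linear_extension_comp
  using assms by (intro linear_extension_cong) (simp add: linear_extension_sum delete_insert_later)

lemma perm_act_contract: "perm_act \<sigma> (contract j f) = contract j (perm_act \<sigma> f)"
  by (simp add: perm_act_linear_extension contract_def linear_extension_comp delete_letter_def take_map drop_map)

lemma perm_act_insert_mean:
  assumes "\<sigma> permutes {1..n}"
  shows "perm_act \<sigma> (insert_mean n j f) = insert_mean n j (perm_act \<sigma> f)"
proof -
  have "(\<Sum>x\<in>{1..n}. Poly_Mapping.single (FWord (map \<sigma> (letters (insert_letter j x w)))) (1 / of_nat n)) =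
    (\<Sum>x\<in>{1..n}. Poly_Mapping.single (insert_letter j x (FWord (map \<sigma> (letters w)))) (1 / of_nat n :: rat))"
    for w
    by (subst sum.permute[OF assms]) (simp add: insert_letter_def take_map drop_map comp_def)
  then show ?thesis
    by (simp add: perm_act_linear_extension insert_mean_def linear_extension_comp linear_extension_sum)
qed

lemma contract_mixed_invariants:
  assumes "f \<in> mixed_invariants n (Suc a) b"
  shows "contract a f \<in> mixed_invariants n a b"
proof -
  have "Poly_Mapping.keys (contract a f) \<subseteq> words n (a + b)"
  proof -
    have "Poly_Mapping.keys (contract a f) \<subseteq> delete_letter a ` Poly_Mapping.keys f"
      unfolding contract_def using keys_linear_extension by fastforce
    also have "\<dots> \<subseteq> delete_letter a ` words n (Suc a + b)"
      using assms by (auto simp: mixed_invariants_def)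
    also have "\<dots> \<subseteq> words n (a + b)"
      by (auto simp: words_def delete_letter_def dest!: in_set_takeD in_set_dropD)
    finally show ?thesis .
  qed
  moreover have "contract j (contract a f) = 0" if "j \<in> {a..<a + b}" for j
  proof -
    have "contract (Suc j) f = 0"
      using that assms by (simp add: mixed_invariants_def)
    then show ?thesis
      using that by (simp add: contract_contract) (simp add: contract_def)
  qed
  ultimately show ?thesis
    using assms by (simp add: mixed_invariants_def perm_act_contract)
qed

lemma insert_mean_mixed_invariants:
  assumes "f \<in> mixed_invariants n a b"
  shows "insert_mean n a f \<in> mixed_invariants n (Suc a) b"
proof -
  have len: "a \<le> length (letters w)" if "w \<in> Poly_Mapping.keys f" for w
    using that assms by (auto simp: mixed_invariants_def words_def)
  have "Poly_Mapping.keys (insert_mean n a f) \<subseteq> words n (Suc a + b)"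
  proof -
    have "Poly_Mapping.keys (insert_mean n a f)
        \<subseteq> (\<Union>w\<in>Poly_Mapping.keys f. \<Union>x\<in>{1..n}. {insert_letter a x w})"
      unfolding insert_mean_def
      by (rule order_trans[OF keys_linear_extension] UN_mono order_refl order_trans[OF keys_sum])+
       auto
    also have "\<dots> \<subseteq> (\<Union>w\<in>words n (a + b). \<Union>x\<in>{1..n}. {insert_letter a x w})"
      using assms by (auto simp: mixed_invariants_def)
    also have "\<dots> \<subseteq> words n (Suc a + b)"
      by (auto simp: words_def insert_letter_def dest!: in_set_takeD in_set_dropD)
    finally show ?thesis .
  qed
  moreover have "contract j (insert_mean n a f) = 0" if "j \<in> {Suc a..<Suc a + b}" for j
  proof -
    obtain i where "j = Suc i" "i \<in> {a..<a + b}" using \<open>j \<in> _\<close> by (cases j) auto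
    then show ?thesis
      using assms len by (simp add: contract_insert_mean_later mixed_invariants_def)
        (simp add: insert_mean_def)
  qed
  moreover have "perm_act \<sigma> (insert_mean n a f) = insert_mean n a f" if "\<sigma> \<in> carrier (sym_group n)" for \<sigma>
    using that assms by (simp add: perm_act_insert_mean sym_group_carrier mixed_invariants_def)
  ultimately show ?thesis
    by (simp add: mixed_invariants_def)
qed

lemma mixed_invariants_kernel:
  "mixed_invariants n a (Suc b) = {f \<in> mixed_invariants n (Suc a) b. contract a f = 0}"
proof -
  have "{a..<a + Suc b} = insert a {Suc a..<Suc a + b}" by auto
  then show ?thesis by (auto simp: mixed_invariants_def)
qed

text \<open>The dimension count for \<open>M = V \<oplus> \<rat>\<close> applied to the factor number \<open>a\<close>. Contraction there and insertion of the
  mean both commute with the group action and with the contractions of the later factors, so the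
  splitting restricts to the invariants.\<close>
lemma has_dim_mixed_invariants_step:
  assumes "n \<ge> 1" "has_dim (mixed_invariants n (Suc a) b) m" "has_dim (mixed_invariants n a b) t"
  shows "\<exists>k. has_dim (mixed_invariants n a (Suc b)) k \<and> m = k + t"
  unfolding mixed_invariants_kernel
proof (rule has_dim_kernel_split_epi[OF _ _ assms(2,3) contract_mixed_invariants insert_mean_mixed_invariants])
  show "Vector_Spaces.linear scale scale (contract a :: nat free_alg \<Rightarrow> _)"
    unfolding contract_def by (rule linear_linear_extension)
  show "Vector_Spaces.linear scale scale (insert_mean n a)"
    unfolding insert_mean_def by (rule linear_linear_extension)
  show "contract a (insert_mean n a y) = y" if "y \<in> mixed_invariants n a b" for y
    using that assms(1)
    by (intro contract_insert_mean_same) (auto simp: mixed_invariants_def words_def)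
qed

lemma contract_mult_left:
  assumes "Poly_Mapping.keys f \<subseteq> words n a" "j < a"
  shows "contract j (f * g) = contract j f * g"
proof -
  have "contract j (f * g) = contract j f * linear_extension (\<lambda>w. Poly_Mapping.single w 1) g"
    unfolding contract_def
    using assms by (intro linear_extension_mult) (auto simp: delete_letter_def plus_fword_def words_def mult_single)
  then show ?thesis by (simp add: linear_extension_monomials)
qed

lemma contract_mult_right:
  assumes "Poly_Mapping.keys f \<subseteq> words n a"
  shows "contract (a + j) (f * g) = f * contract j g"
proof -
  have "contract (a + j) (f * g) = linear_extension (\<lambda>w. Poly_Mapping.single w 1) f * contract j g"
    unfolding contract_def
    using assms by (intro linear_extension_mult) (auto simp: delete_letter_def plus_fword_def words_def mult_single)
  then show ?thesis by (simp add: linear_extension_monomials)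
qed

section \<open>Tensor powers of the geometric module as kernels\<close>

definition contraction_kernel :: "nat \<Rightarrow> nat \<Rightarrow> nat free_alg set"
  where "contraction_kernel n d = {f. Poly_Mapping.keys f \<subseteq> words n d \<and> (\<forall>j<d. contract j f = 0)}"

lemma subspace_contraction_kernel: "free_alg.subspace (contraction_kernel n d)"
  using subspace_keys[of "words n d"]
  by (auto simp: contraction_kernel_def free_alg.subspace_def contract_def linear_extension_add linear_extension_scale)

lemma contraction_kernel_mult:
  assumes f: "f \<in> contraction_kernel n a" and g: "g \<in> contraction_kernel n b"
  shows "f * g \<in> contraction_kernel n (a + b)"
proof -
  have "Poly_Mapping.keys (f * g) \<subseteq> words n (a + b)"
    using f g Poly_Mapping.keys_mult[of f g]
    by (fastforce simp: contraction_kernel_def words_def plus_fword_def)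
  moreover have "contract j (f * g) = 0" if "j < a + b" for j
  proof (cases "j < a")
    case True
    then show ?thesis
      using f contract_mult_left[of f n a j g] by (simp add: contraction_kernel_def)
  next
    case False
    then show ?thesis
      using that f g contract_mult_right[of f n a "j - a" g] by (simp add: contraction_kernel_def)
  qed
  ultimately show ?thesis by (simp add: contraction_kernel_def)
qed

lemma one_contraction_kernel: "1 \<in> contraction_kernel n 0"
  by (auto simp: contraction_kernel_def words_def zero_fword_def)

lemma geometric_module_contraction_kernel: "geometric_module n \<subseteq> contraction_kernel n 1"
  unfolding geometric_module_def
proof (rule free_alg.span_minimal[OF _ subspace_contraction_kernel], rule)
  fix b assume "b \<in> geometric_basis n"
  then obtain i where i: "b = var i - var (i + 1)" "1 \<le> i" "i \<le> n - 1"
    by (auto simp: geometric_basis_def)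
  have "Poly_Mapping.keys b \<subseteq> {FWord [i], FWord [i + 1]}"
    unfolding i(1) var_def by (rule order_trans[OF keys_diff]) auto
  also have "\<dots> \<subseteq> words n 1"
    using i by (auto simp: words_def)
  finally show "b \<in> contraction_kernel n 1"
    by (simp add: contraction_kernel_def i(1) contract_def linear_extension_diff var_def delete_letter_def)
qed

lemma prod_list_contraction_kernel:
  assumes "\<And>v. v \<in> set vs \<Longrightarrow> v \<in> contraction_kernel n (\<delta> v)"
  shows "prod_list vs \<in> contraction_kernel n (sum_list (map \<delta> vs))"
  using assms by (induction vs) (simp_all add: one_contraction_kernel contraction_kernel_mult)

lemma var_diff_geometric:
  assumes "1 \<le> x" "x \<le> n"
  shows "var x - var n \<in> geometric_module n"
  using assms(2,1)
proof (induction x rule: inc_induct)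
  case base
  show ?case by (simp add: geometric_module_def free_alg.span_zero)
next
  case (step x)
  have "var x - var (x + 1) \<in> geometric_module n"
    using step unfolding geometric_module_def geometric_basis_def
    by (intro free_alg.span_base) auto
  moreover have "var (Suc x) - var n \<in> geometric_module n"
    using step by simp
  ultimately have "(var x - var (x + 1)) + (var (Suc x) - var n) \<in> geometric_module n"
    unfolding geometric_module_def by (rule free_alg.span_add)
  then show ?case by simp
qed

text \<open>One inclusion holds for products of elements of \<open>V\<close>. For the other one, \<open>x\<^sub>i \<mapsto> x\<^sub>i - x\<^sub>n\<close> is a projection
  of the permutation module onto \<open>V\<close> along \<open>x\<^sub>n\<close>. It is applied to one tensor factor after the other; as the
  contraction of this factor vanishes, the element is not changed, and in the end it is visibly in
  the tensor power of \<open>V\<close>.\<close>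
lemma tensor_power_eq_contraction_kernel:
  "tensor_power (geometric_module n) d = contraction_kernel n d"
proof
  have "prod_list vs \<in> contraction_kernel n d" if "length vs = d" "set vs \<subseteq> geometric_module n" for vs
    using that prod_list_contraction_kernel[of vs n "\<lambda>_. 1"] geometric_module_contraction_kernel
    by (auto simp: sum_list_triv)
  then show "tensor_power (geometric_module n) d \<subseteq> contraction_kernel n d"
    unfolding tensor_power_def by (intro free_alg.span_minimal subspace_contraction_kernel) blast
next
  define v where "v x = var x - var n" for x
  \<comment> \<open>the word \<open>w\<close> with its first \<open>i\<close> letters projected to the geometric module\<close>
  define h where
    "h i w = prod_list (map v (take i (letters w))) * Poly_Mapping.single (FWord (drop i (letters w))) (1 :: rat)"
    for i w
  show "contraction_kernel n d \<subseteq> tensor_power (geometric_module n) d"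
  proof
    fix f assume "f \<in> contraction_kernel n d"
    then have f: "Poly_Mapping.keys f \<subseteq> words n d" "\<And>j. j < d \<Longrightarrow> contract j f = 0"
      by (auto simp: contraction_kernel_def)
    have "linear_extension (h i) f = f" if "i \<le> d" for i
      using that
    proof (induction i)
      case 0
      have "h 0 w = Poly_Mapping.single w 1" for w
        by (simp add: h_def)
      then show ?case by (simp add: linear_extension_monomials)
    next
      case (Suc i)
      let ?k = "\<lambda>w. prod_list (map v (take i (letters w))) * var n *
        Poly_Mapping.single (FWord (drop i (letters w))) (1 :: rat)"
      \<comment> \<open>the correction depends only on the word without the letter number \<open>i\<close>, so it is a function
        of the contraction\<close>
      have "h (Suc i) w = h i w - ?k (delete_letter i w)" if "w \<in> Poly_Mapping.keys f" for w
      proof -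
        have i: "i < length (letters w)"
          using that f Suc.prems by (auto simp: words_def)
        then have "Poly_Mapping.single (FWord (drop i (letters w))) (1 :: rat) =
            var (letters w ! i) * Poly_Mapping.single (FWord (drop (Suc i) (letters w))) 1"
          by (simp add: var_def mult_single plus_fword_def Cons_nth_drop_Suc)
        then show ?thesis
          using i by (simp add: h_def v_def delete_letter_def take_Suc_conv_app_nth algebra_simps)
      qed
      then have "linear_extension (h (Suc i)) f = linear_extension (\<lambda>w. h i w - ?k (delete_letter i w)) f"
        by (rule linear_extension_cong)
      also have "\<dots> = linear_extension (h i) f - linear_extension ?k (contract i f)"
        by (simp add: linear_extension_minus_fun contract_def linear_extension_comp)
      also have "\<dots> = f"
        using Suc f by simp
      finally show ?case .
    qed
    then have "f = linear_extension (h d) f" by simp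
    also have "\<dots> \<in> tensor_power (geometric_module n) d"
      unfolding linear_extension_def tensor_power_def
    proof (intro free_alg.span_sum free_alg.span_scale free_alg.span_base)
      fix w assume "w \<in> Poly_Mapping.keys f"
      then have w: "length (letters w) = d" "set (letters w) \<subseteq> {1..n}"
        using f by (auto simp: words_def)
      then have "h d w = prod_list (map v (letters w))"
        by (simp add: h_def flip: zero_fword_def)
      then show "h d w \<in> {prod_list vs |vs. length vs = d \<and> set vs \<subseteq> geometric_module n}"
        using w var_diff_geometric[of _ n] by (force simp: v_def)
    qed
    finally show "f \<in> tensor_power (geometric_module n) d" .
  qed
qed

lemma mixed_invariants_0:
  "mixed_invariants n 0 d = tensor_power (geometric_module n) d \<inter> invariant_algebra n"
proof -
  have "tensor_power (geometric_module n) d \<subseteq> tensor_algebra (geometric_module n)"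
    unfolding tensor_algebra_def by (rule order_trans[OF _ free_alg.span_superset]) auto
  then show ?thesis
    by (auto simp: mixed_invariants_def invariant_algebra_def tensor_power_eq_contraction_kernel contraction_kernel_def)
qed

section \<open>Products of cycles as moves to the front\<close>

definition one_line :: "nat \<Rightarrow> (nat \<Rightarrow> nat) \<Rightarrow> nat list"
  where "one_line n \<pi> = map \<pi> [1..<Suc n]"

text \<open>The labels that are moved to the front when \<open>\<pi>\<close> is successively multiplied from the right by the
  cycles with indices \<open>ks\<close>.\<close>
primrec front_labels :: "(nat \<Rightarrow> nat) \<Rightarrow> nat list \<Rightarrow> nat list" where
  "front_labels \<pi> [] = []"
| "front_labels \<pi> (k # ks) = \<pi> k # front_labels (\<pi> \<circ> cayley_cycle k) ks"

definition cycle_product :: "nat list \<Rightarrow> nat \<Rightarrow> nat"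
  where "cycle_product ks = foldr (\<circ>) (map cayley_cycle ks) id"

lemma upt_split: "i \<le> j \<Longrightarrow> j \<le> k \<Longrightarrow> [i..<k] = [i..<j] @ [j..<k]"
  by (metis le_add_diff_inverse upt_add_eq_append)

lemma cycle_product_Nil: "cycle_product [] = id"
  and cycle_product_Cons: "cycle_product (k # ks) = cayley_cycle k \<circ> cycle_product ks"
  by (simp_all add: cycle_product_def)

lemma cayley_cycle_permutes:
  assumes "k \<in> {1..n}"
  shows "cayley_cycle k permutes {1..n}"
proof -
  have "cayley_cycle k permutes set (1 # rev [2..<k + 1])"
    unfolding cayley_cycle_def by (rule cycle_permutes)
  then show ?thesis
    by (rule permutes_subset) (use assms in auto)
qed

text \<open>Applying a permutation \<open>\<pi>\<close> to both sides shows how right multiplication by \<open>c\<^sub>k\<close> acts on the one-line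
  notation of \<open>\<pi>\<close>: the entry number \<open>k\<close> moves to the front.\<close>
lemma map_cayley_cycle:
  assumes "k \<in> {1..n}"
  shows "map (cayley_cycle k) [1..<Suc n] = k # [1..<k] @ [Suc k..<Suc n]"
proof -
  let ?c = "1 # rev [2..<k + 1]"
  have "map (cayley_cycle k) ?c = rotate1 ?c"
    using cyclic_rotation[of ?c 1] by (simp add: cayley_cycle_def)
  then have "rev (cayley_cycle k 1 # rev (map (cayley_cycle k) [2..<k + 1])) = rev (rev [2..<k + 1] @ [1])"
    by (simp add: rev_map)
  also have "\<dots> = [1..<Suc k]"
    using assms upt_rec[of 1 "Suc k"] by (simp add: numeral_2_eq_2 del: upt_Suc)
  also have "\<dots> = [1..<k] @ [k]"
    using assms by simp
  finally have "map (cayley_cycle k) [2..<k + 1] = [1..<k]" "cayley_cycle k 1 = k"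
    by simp_all
  moreover have "map (cayley_cycle k) [Suc k..<Suc n] = [Suc k..<Suc n]"
    using cycle_permutes[of ?c] id_outside_supp[of _ ?c]
    by (intro map_idI) (auto simp: cayley_cycle_def)
  moreover have "[1..<Suc n] = 1 # [2..<k + 1] @ [Suc k..<Suc n]"
    using assms upt_rec[of 1 "Suc n"] upt_split[of 2 "k + 1" "Suc n"]
    by (simp add: numeral_2_eq_2 del: upt_Suc)
  ultimately show ?thesis by simp
qed

lemma one_line_cycle:
  assumes "\<pi> permutes {1..n}" "k \<in> {1..n}"
  shows "one_line n (\<pi> \<circ> cayley_cycle k) = \<pi> k # filter (\<lambda>x. x \<noteq> \<pi> k) (one_line n \<pi>)"
proof -
  have "one_line n (\<pi> \<circ> cayley_cycle k) = map \<pi> (map (cayley_cycle k) [1..<Suc n])"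
    unfolding one_line_def by (simp only: map_map)
  also have "\<dots> = \<pi> k # map \<pi> ([1..<k] @ [Suc k..<Suc n])"
    by (simp only: map_cayley_cycle[OF assms(2)] list.map)
  also have "[1..<k] @ [Suc k..<Suc n] = filter (\<lambda>i. i \<noteq> k) [1..<Suc n]"
  proof -
    have "[1..<Suc n] = [1..<k] @ k # [Suc k..<Suc n]"
      using assms(2) upt_split[of 1 k "Suc n"] upt_rec[of k "Suc n"] by (simp del: upt_Suc)
    moreover have "filter (\<lambda>i. i \<noteq> k) [1..<k] = [1..<k]"
      "filter (\<lambda>i. i \<noteq> k) [Suc k..<Suc n] = [Suc k..<Suc n]"
      by (auto simp: filter_id_conv)
    ultimately show ?thesis by simp
  qed
  finally show ?thesis
    using assms(1) by (simp add: one_line_def filter_map comp_def permutes_inj inj_eq del: upt_Suc)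
qed

text \<open>The function \<open>remdups\<close> keeps last occurrences, so its reversal lists the moved labels by the time of
  their last move, the latest first.\<close>
lemma one_line_product:
  assumes "\<pi> permutes {1..n}" "set ks \<subseteq> {1..n}"
  shows "one_line n (\<pi> \<circ> cycle_product ks) =
    rev (remdups (front_labels \<pi> ks)) @ filter (\<lambda>x. x \<notin> set (front_labels \<pi> ks)) (one_line n \<pi>)"
  using assms
proof (induction ks arbitrary: \<pi>)
  case Nil
  then show ?case by (simp add: cycle_product_def)
next
  case (Cons k ks)
  let ?\<rho> = "\<pi> \<circ> cayley_cycle k"
  have \<rho>: "?\<rho> permutes {1..n}"
    using Cons.prems cayley_cycle_permutes by (intro permutes_compose) auto
  have "\<pi> \<circ> cycle_product (k # ks) = ?\<rho> \<circ> cycle_product ks"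
    by (simp add: cycle_product_Cons comp_assoc)
  moreover have "one_line n (?\<rho> \<circ> cycle_product ks) =
    rev (remdups (front_labels ?\<rho> ks)) @ filter (\<lambda>x. x \<notin> set (front_labels ?\<rho> ks)) (one_line n ?\<rho>)"
    by (rule Cons.IH[OF \<rho>]) (use Cons.prems in auto)
  moreover have "one_line n ?\<rho> = \<pi> k # filter (\<lambda>x. x \<noteq> \<pi> k) (one_line n \<pi>)"
    using Cons.prems by (intro one_line_cycle) auto
  ultimately have "one_line n (\<pi> \<circ> cycle_product (k # ks)) =
    rev (remdups (front_labels \<pi> (k # ks))) @
      filter (\<lambda>x. x \<notin> set (front_labels \<pi> (k # ks))) (one_line n \<pi>)"
    by (auto simp: conj_commute)
  then show ?case .
qed

lemma front_labels_length [simp]: "length (front_labels \<pi> ks) = length ks"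
  by (induction ks arbitrary: \<pi>) auto

lemma front_labels_set:
  assumes "\<pi> permutes {1..n}" "set ks \<subseteq> {1..n}"
  shows "set (front_labels \<pi> ks) \<subseteq> {1..n}"
  using assms
proof (induction ks arbitrary: \<pi>)
  case (Cons k ks)
  have "\<pi> \<circ> cayley_cycle k permutes {1..n}"
    using Cons.prems cayley_cycle_permutes by (intro permutes_compose) auto
  then show ?case
    using Cons permutes_in_image[OF Cons.prems(1), of k] by simp
qed simp

text \<open>Knowing the current arrangement, the label determines the position it was taken from.\<close>
lemma front_labels_inj:
  assumes "\<pi> permutes {1..n}" "set ks \<subseteq> {1..n}" "set ls \<subseteq> {1..n}"
    and "front_labels \<pi> ks = front_labels \<pi> ls"
  shows "ks = ls"
  using assms
proof (induction ks arbitrary: \<pi> ls)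
  case Nil
  then show ?case by (cases ls) auto
next
  case (Cons k ks)
  then obtain l ls' where ls: "ls = l # ls'" by (cases ls) auto
  have "k = l"
    using Cons.prems(1,4) ls by (simp add: permutes_inj inj_eq)
  moreover have "\<pi> \<circ> cayley_cycle k permutes {1..n}"
    using Cons.prems cayley_cycle_permutes by (intro permutes_compose) auto
  ultimately show ?case
    using Cons.IH[of "\<pi> \<circ> cayley_cycle k" ls'] Cons.prems(2-4) ls
    by (metis front_labels.simps(2) list.inject list.set_intros(2) subset_code(1))
qed

lemma cycle_product_permutes: "set ks \<subseteq> {1..n} \<Longrightarrow> cycle_product ks permutes {1..n}"
proof (induction ks)
  case Nil
  show ?case unfolding cycle_product_Nil by (rule permutes_id)
next
  case (Cons k ks)
  then show ?case
    unfolding cycle_product_Cons by (intro permutes_compose cayley_cycle_permutes) auto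
qed

lemma one_line_id_iff:
  assumes "\<pi> permutes {1..n}"
  shows "one_line n \<pi> = [1..<Suc n] \<longleftrightarrow> \<pi> = id"
proof
  assume "one_line n \<pi> = [1..<Suc n]"
  then have "map \<pi> [1..<Suc n] = map id [1..<Suc n]"
    by (simp only: one_line_def list.map_id)
  then have *: "\<pi> x = x" if "x \<in> {1..n}" for x
    using that unfolding map_eq_conv by (metis atLeastAtMost_iff atLeastLessThan_iff id_apply le_imp_less_Suc set_upt)
  then show "\<pi> = id"
    using assms by (auto simp: fun_eq_iff permutes_def)
qed (simp add: one_line_def del: upt_Suc)

text \<open>The sequences of labels that lead from the identity arrangement back to it; they turn out to
  represent the orbits of the symmetric group on words.\<close>
definition orbit_representatives :: "nat \<Rightarrow> nat \<Rightarrow> nat list set"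
  where "orbit_representatives n d = {xs. length xs = d \<and> set xs \<subseteq> {1..n} \<and>
    rev (remdups xs) @ filter (\<lambda>x. x \<notin> set xs) [1..<Suc n] = [1..<Suc n]}"

text \<open>Closed words are recorded by the indices of their letters, the index \<open>1\<close> standing for the identity.
  It may occur in the first \<open>a\<close> places only.\<close>
definition closed_words :: "nat \<Rightarrow> nat \<Rightarrow> nat \<Rightarrow> nat list set"
  where "closed_words n a b = {ks. length ks = a + b \<and> set ks \<subseteq> {1..n} \<and> set (drop a ks) \<subseteq> {2..n} \<and>
    cycle_product ks = id}"

text \<open>By injectivity on a finite set, every word of labels arises from exactly one word of indices.\<close>
lemma card_closed_words_0: "card (closed_words n d 0) = card (orbit_representatives n d)"
proof -
  let ?L = "{ks. set ks \<subseteq> {1..n} \<and> length ks = d}"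
  have "finite ?L" by (rule finite_lists_length_eq) simp
  moreover have "front_labels id ` ?L \<subseteq> ?L"
    using front_labels_set[OF permutes_id] by auto
  moreover have inj: "inj_on (front_labels id) ?L"
    by (rule inj_onI) (use front_labels_inj[OF permutes_id] in blast)
  ultimately have surj: "front_labels id ` ?L = ?L"
    by (rule endo_inj_surj)
  have iff: "ks \<in> closed_words n d 0 \<longleftrightarrow> front_labels id ks \<in> orbit_representatives n d" if "ks \<in> ?L" for ks
    using that one_line_product[OF permutes_id, of ks n] front_labels_set[OF permutes_id, of ks n]
      one_line_id_iff[OF cycle_product_permutes, of ks n]
    by (auto simp: closed_words_def orbit_representatives_def one_line_def simp del: upt_Suc)
  have "bij_betw (front_labels id) (closed_words n d 0) (orbit_representatives n d)"
  proof (rule bij_betw_imageI)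
    show "inj_on (front_labels id) (closed_words n d 0)"
      by (rule inj_on_subset[OF inj]) (auto simp: closed_words_def)
    show "front_labels id ` closed_words n d 0 = orbit_representatives n d"
    proof
      show "front_labels id ` closed_words n d 0 \<subseteq> orbit_representatives n d"
        using iff by (auto simp: closed_words_def)
      show "orbit_representatives n d \<subseteq> front_labels id ` closed_words n d 0"
      proof
        fix xs assume xs: "xs \<in> orbit_representatives n d"
        then have "xs \<in> front_labels id ` ?L"
          unfolding surj by (simp add: orbit_representatives_def)
        then obtain ks where "ks \<in> ?L" "xs = front_labels id ks" by blast
        then show "xs \<in> front_labels id ` closed_words n d 0" using iff xs by blast
      qed
    qed
  qed
  then show ?thesis by (rule bij_betw_same_card)
qed

lemma cayley_cycle_1: "cayley_cycle (Suc 0) = id"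
  by (simp add: cayley_cycle_def)

lemma cycle_product_append: "cycle_product (xs @ ys) = cycle_product xs \<circ> cycle_product ys"
  by (induction xs) (simp_all add: cycle_product_Nil cycle_product_Cons comp_assoc)

lemma finite_closed_words: "finite (closed_words n a b)"
  by (rule finite_subset[OF _ finite_lists_length_eq[of "{1..n}" "a + b"]]) (auto simp: closed_words_def)

text \<open>Either the letter number \<open>a\<close> is not the identity, or it can be removed without changing the product.\<close>
lemma card_closed_words_step:
  assumes "n \<ge> 1"
  shows "card (closed_words n (Suc a) b) = card (closed_words n a (Suc b)) + card (closed_words n a b)"
proof -
  let ?ins = "\<lambda>ks :: nat list. take a ks @ 1 # drop a ks"
  have 1: "closed_words n (Suc a) b = closed_words n a (Suc b) \<union> ?ins ` closed_words n a b"
  proof (rule Set.set_eqI, rule iffI)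
    fix ks assume ks: "ks \<in> closed_words n (Suc a) b"
    then have a: "a < length ks" by (simp add: closed_words_def)
    then have eq: "ks = take a ks @ ks ! a # drop (Suc a) ks" by (rule id_take_nth_drop)
    show "ks \<in> closed_words n a (Suc b) \<union> ?ins ` closed_words n a b"
    proof (cases "ks ! a = 1")
      case False
      have "ks ! a \<in> {1..n}"
        using ks nth_mem[OF a] unfolding closed_words_def by blast
      then have "ks ! a \<in> {2..n}"
        using False by auto
      moreover have "drop a ks = ks ! a # drop (Suc a) ks"
        using a by (simp add: Cons_nth_drop_Suc)
      ultimately have "set (drop a ks) \<subseteq> {2..n}"
        using ks by (simp add: closed_words_def)
      then show ?thesis using ks by (simp add: closed_words_def)
    next
      case True
      let ?ls = "take a ks @ drop (Suc a) ks"
      have "cycle_product ?ls = cycle_product (take a ks @ ks ! a # drop (Suc a) ks)"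
        unfolding True cycle_product_append by (simp add: cycle_product_Cons cayley_cycle_1)
      then have "cycle_product ?ls = id"
        using ks eq by (simp add: closed_words_def)
      moreover have "set ?ls \<subseteq> {1..n}"
        using ks by (auto simp: closed_words_def dest: in_set_takeD in_set_dropD)
      ultimately have "?ls \<in> closed_words n a b"
        using ks a by (simp add: closed_words_def)
      moreover have "ks = ?ins ?ls" using eq True a by simp
      ultimately show ?thesis by blast
    qed
  next
    fix ks assume "ks \<in> closed_words n a (Suc b) \<union> ?ins ` closed_words n a b"
    then show "ks \<in> closed_words n (Suc a) b"
    proof
      assume "ks \<in> closed_words n a (Suc b)"
      moreover have "set (drop (Suc a) ks) \<subseteq> set (drop a ks)"
        by (rule set_drop_subset_set_drop) simp
      ultimately show ?thesis by (auto simp: closed_words_def)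
    next
      assume "ks \<in> ?ins ` closed_words n a b"
      then obtain ls where ls: "ks = ?ins ls" "ls \<in> closed_words n a b" by blast
      have "cycle_product ks = cycle_product (take a ls @ drop a ls)"
        unfolding ls(1) cycle_product_append by (simp add: cycle_product_Cons cayley_cycle_1)
      then show ?thesis
        using ls assms by (auto simp: closed_words_def dest: in_set_takeD in_set_dropD)
    qed
  qed
  have "ks ! a \<ge> 2" if "ks \<in> closed_words n a (Suc b)" for ks
  proof -
    have "drop a ks ! 0 \<in> set (drop a ks)" using that by (intro nth_mem) (simp add: closed_words_def)
    then show ?thesis using that by (auto simp: closed_words_def)
  qed
  moreover have "?ins ks ! a = 1" if "ks \<in> closed_words n a b" for ks
    using that by (simp add: closed_words_def nth_append)
  ultimately have "closed_words n a (Suc b) \<inter> ?ins ` closed_words n a b = {}"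
    by fastforce
  moreover have "inj_on ?ins (closed_words n a b)"
  proof (rule inj_on_inverseI)
    fix ks assume "ks \<in> closed_words n a b"
    then show "take a (?ins ks) @ drop (Suc a) (?ins ks) = ks"
      by (simp add: closed_words_def)
  qed
  ultimately show ?thesis
    unfolding 1 by (simp add: card_Un_disjoint finite_closed_words card_image)
qed

section \<open>Orbit sums\<close>

lemma remdups_map_injective: "inj f \<Longrightarrow> remdups (map f xs) = map f (remdups xs)"
  by (induction xs) (auto simp: inj_eq)

lemma orbit_representatives_iff:
  assumes "set xs \<subseteq> {1..n}"
  shows "xs \<in> orbit_representatives n d \<longleftrightarrow>
    length xs = d \<and> rev (remdups xs) = [1..<Suc (card (set xs))]"
proof -
  let ?m = "card (set xs)"
  have m: "?m \<le> n" using card_mono[OF _ assms] by simp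
  have "rev (remdups xs) @ filter (\<lambda>x. x \<notin> set xs) [1..<Suc n] = [1..<Suc n] \<longleftrightarrow>
    rev (remdups xs) = [1..<Suc ?m]" (is "?l \<longleftrightarrow> ?r")
  proof
    assume ?l
    then have "take ?m (rev (remdups xs) @ filter (\<lambda>x. x \<notin> set xs) [1..<Suc n]) = take ?m [1..<Suc n]"
      by simp
    then show ?r using m by (simp add: length_remdups_card_conv del: upt_Suc)
  next
    assume r: ?r
    have "set xs = set (rev (remdups xs))" by simp
    also have "\<dots> = {1..?m}" unfolding r by auto
    finally have "set xs = {1..?m}" .
    then have mem: "x \<in> set xs \<longleftrightarrow> 1 \<le> x \<and> x \<le> ?m" for x
      unfolding set_eq_iff by simp
    have "filter (\<lambda>x. x \<notin> set xs) [1..<Suc ?m] = []"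
      "filter (\<lambda>x. x \<notin> set xs) [Suc ?m..<Suc n] = [Suc ?m..<Suc n]"
      unfolding filter_empty_conv filter_id_conv by (auto simp: mem)
    then show ?l
      using r m upt_split[of 1 "Suc ?m" "Suc n"] by (simp del: upt_Suc)
  qed
  then show ?thesis using assms by (simp add: orbit_representatives_def)
qed

lemma permutation_sorting_list:
  assumes "distinct L" "set L = {1..n}"
  obtains \<sigma> where "\<sigma> permutes {1..n}" "map \<sigma> L = [1..<Suc n]"
proof -
  have len: "length L = n" using assms distinct_card by fastforce
  define \<tau> where "\<tau> i = (if i \<in> {1..n} then L ! (i - 1) else i)" for i
  have "bij_betw ((!) L) {..<n} {1..n}"
    using assms len by (simp add: bij_betw_nth)
  moreover have "bij_betw (\<lambda>i. i - 1) {1..n} {..<n}"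
    by (rule bij_betw_byWitness[of _ Suc]) auto
  ultimately have "bij_betw ((!) L \<circ> (\<lambda>i. i - 1)) {1..n} {1..n}"
    by (metis bij_betw_trans)
  then have "bij_betw \<tau> {1..n} {1..n}"
    by (rule bij_betw_cong[THEN iffD1, rotated]) (simp add: \<tau>_def)
  then have \<tau>: "\<tau> permutes {1..n}"
    by (rule bij_imp_permutes) (auto simp: \<tau>_def)
  have "map \<tau> [1..<Suc n] = L"
    by (rule nth_equalityI) (auto simp: len \<tau>_def simp del: upt_Suc)
  then have "map (inv' \<tau>) L = [1..<Suc n]"
    using \<tau> by (auto simp: permutes_inverses(2) map_idI simp del: upt_Suc)
  then show thesis using that permutes_inv[OF \<tau>] by blast
qed

text \<open>The permutation sends the arrangement reached by the labels \<open>xs\<close> to the identity arrangement.\<close>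
lemma orbit_representative_exists:
  assumes "set xs \<subseteq> {1..n}"
  obtains \<sigma> where "\<sigma> permutes {1..n}" "map \<sigma> xs \<in> orbit_representatives n (length xs)"
proof -
  let ?L = "rev (remdups xs) @ filter (\<lambda>x. x \<notin> set xs) [1..<Suc n]" and ?m = "card (set xs)"
  have "distinct ?L" "set ?L = {1..n}" using assms by auto
  then obtain \<sigma> where \<sigma>: "\<sigma> permutes {1..n}" "map \<sigma> ?L = [1..<Suc n]"
    by (rule permutation_sorting_list)
  have inj: "inj \<sigma>" using \<sigma>(1) by (rule permutes_inj)
  have m: "?m \<le> n" using card_mono[OF _ assms] by simp
  have "rev (remdups (map \<sigma> xs)) = map \<sigma> (rev (remdups xs))"
    using inj by (simp add: remdups_map_injective rev_map)
  also have "\<dots> = take ?m (map \<sigma> ?L)"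
    by (simp add: length_remdups_card_conv)
  also have "\<dots> = [1..<Suc ?m]"
    unfolding \<sigma>(2) using m by (simp del: upt_Suc)
  also have "?m = card (set (map \<sigma> xs))"
    using inj by (simp add: card_image inj_on_subset)
  finally have "map \<sigma> xs \<in> orbit_representatives n (length xs)"
    using assms permutes_image[OF \<sigma>(1)] by (subst orbit_representatives_iff) auto
  then show thesis using that \<sigma>(1) by blast
qed

text \<open>Such a \<open>\<sigma>\<close> fixes the sequence \<open>1, \<dots>, m\<close> of the letters of \<open>xs\<close>, ordered by last occurrence, and hence
  each letter of \<open>xs\<close>.\<close>
lemma orbit_representative_unique:
  assumes "\<sigma> permutes {1..n}" "xs \<in> orbit_representatives n d" "map \<sigma> xs \<in> orbit_representatives n d"
  shows "map \<sigma> xs = xs"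
proof -
  have inj: "inj \<sigma>" using assms(1) by (rule permutes_inj)
  have sub: "set xs \<subseteq> {1..n}" "set (map \<sigma> xs) \<subseteq> {1..n}"
    using assms unfolding orbit_representatives_def by blast+
  have "card (set (map \<sigma> xs)) = card (set xs)"
    using inj by (simp add: card_image inj_on_subset)
  then have "map \<sigma> (rev (remdups xs)) = rev (remdups xs)"
    using assms(2,3) sub inj by (simp add: orbit_representatives_iff remdups_map_injective rev_map del: upt_Suc)
  then have "\<sigma> x = x" if "x \<in> set xs" for x
    using that map_eq_conv[of \<sigma> "rev (remdups xs)" id] by simp
  then show ?thesis by (simp add: map_idI)
qed

definition word_orbit :: "nat \<Rightarrow> nat list \<Rightarrow> nat list set"
  where "word_orbit n xs = {map \<sigma> xs |\<sigma>. \<sigma> permutes {1..n}}"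

definition orbit_sum :: "nat \<Rightarrow> nat list \<Rightarrow> nat free_alg"
  where "orbit_sum n xs = (\<Sum>ys\<in>word_orbit n xs. Poly_Mapping.single (FWord ys) 1)"

lemma finite_word_orbit: "finite (word_orbit n xs)"
proof -
  have "word_orbit n xs = (\<lambda>\<sigma>. map \<sigma> xs) ` {\<sigma>. \<sigma> permutes {1..n}}"
    by (auto simp: word_orbit_def)
  then show ?thesis by (simp add: finite_permutations)
qed

lemma lookup_orbit_sum:
  "Poly_Mapping.lookup (orbit_sum n xs) (FWord ys) = (if ys \<in> word_orbit n xs then 1 else 0)"
  using finite_word_orbit[of n xs]
  by (simp add: orbit_sum_def lookup_sum lookup_single when_def)

lemma lookup_perm_act:
  assumes "inj \<sigma>"
  shows "Poly_Mapping.lookup (perm_act \<sigma> f) (FWord (map \<sigma> xs)) = Poly_Mapping.lookup f (FWord xs)"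
proof -
  have eq: "FWord (map \<sigma> (letters w)) = FWord (map \<sigma> xs) \<longleftrightarrow> w = FWord xs" for w
    using assms by (cases w) (auto simp: inj_map_eq_map)
  have "Poly_Mapping.lookup (perm_act \<sigma> f) (FWord (map \<sigma> xs)) =
    (\<Sum>w\<in>Poly_Mapping.keys f. if w = FWord xs then Poly_Mapping.lookup f w else 0)"
    unfolding perm_act_linear_extension linear_extension_def lookup_sum
    by (rule sum.cong) (auto simp: lookup_single when_def eq simp del: fword.inject)
  also have "\<dots> = Poly_Mapping.lookup f (FWord xs)"
    by (simp add: in_keys_iff)
  finally show ?thesis .
qed

lemma perm_act_orbit_sum:
  assumes \<sigma>: "\<sigma> permutes {1..n}"
  shows "perm_act \<sigma> (orbit_sum n xs) = orbit_sum n xs"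
proof -
  have inj: "inj_on (map \<sigma>) (word_orbit n xs)"
    using permutes_inj[OF \<sigma>] by (simp add: inj_on_def inj_map_eq_map)
  have "map \<sigma> ` word_orbit n xs \<subseteq> word_orbit n xs"
  proof clarify
    fix ys assume "ys \<in> word_orbit n xs"
    then obtain \<tau> where "\<tau> permutes {1..n}" "ys = map \<tau> xs" by (auto simp: word_orbit_def)
    then show "map \<sigma> ys \<in> word_orbit n xs"
      unfolding word_orbit_def using permutes_compose[OF _ \<sigma>, of \<tau>] by (auto intro!: exI[of _ "\<sigma> \<circ> \<tau>"])
  qed
  then have "map \<sigma> ` word_orbit n xs = word_orbit n xs"
    using inj finite_word_orbit by (metis endo_inj_surj)
  then have "bij_betw (map \<sigma>) (word_orbit n xs) (word_orbit n xs)"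
    using inj by (simp add: bij_betw_def)
  then have "(\<Sum>ys\<in>word_orbit n xs. Poly_Mapping.single (FWord (map \<sigma> ys)) 1) = orbit_sum n xs"
    unfolding orbit_sum_def by (rule sum.reindex_bij_betw)
  moreover have "perm_act \<sigma> (orbit_sum n xs) =
      (\<Sum>ys\<in>word_orbit n xs. Poly_Mapping.single (FWord (map \<sigma> ys)) 1)"
    by (simp add: orbit_sum_def perm_act_linear_extension linear_extension_sum)
  ultimately show ?thesis by simp
qed

lemma word_orbit_letters:
  assumes "ys \<in> word_orbit n xs"
  shows "length ys = length xs" "set ys \<subseteq> {1..n} \<longleftrightarrow> set xs \<subseteq> {1..n}"
proof -
  obtain \<sigma> where \<sigma>: "\<sigma> permutes {1..n}" "ys = map \<sigma> xs"
    using assms by (auto simp: word_orbit_def)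
  show "length ys = length xs" by (simp add: \<sigma>)
  show "set ys \<subseteq> {1..n} \<longleftrightarrow> set xs \<subseteq> {1..n}"
    unfolding \<sigma>(2) subset_iff using permutes_in_image[OF \<sigma>(1)] by auto
qed

lemma finite_orbit_representatives: "finite (orbit_representatives n d)"
  by (rule finite_subset[OF _ finite_lists_length_eq[of "{1..n}" d]])
    (unfold orbit_representatives_def, blast, simp)

text \<open>The orbit sums of the representatives form a basis: an invariant element has constant coefficients on
  orbits, and each orbit contains exactly one representative.\<close>
lemma has_dim_mixed_invariants_0:
  "has_dim (mixed_invariants n d 0) (card (orbit_representatives n d))"
proof -
  let ?R = "orbit_representatives n d"
  have dual: "Poly_Mapping.lookup (orbit_sum n xs) (FWord ys) = (if xs = ys then 1 else 0)"
    if "xs \<in> ?R" "ys \<in> ?R" for xs ys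
  proof -
    have "xs \<in> word_orbit n xs"
      unfolding word_orbit_def using permutes_id by (auto intro!: exI[of _ id])
    moreover have "xs = ys" if "ys \<in> word_orbit n xs"
    proof -
      obtain \<sigma> where "\<sigma> permutes {1..n}" "ys = map \<sigma> xs"
        using \<open>ys \<in> word_orbit n xs\<close> by (auto simp: word_orbit_def)
      then show ?thesis
        using orbit_representative_unique \<open>xs \<in> ?R\<close> \<open>ys \<in> ?R\<close> by metis
    qed
    ultimately show ?thesis by (auto simp: lookup_orbit_sum)
  qed
  have "free_alg.span (orbit_sum n ` ?R) = mixed_invariants n d 0"
  proof
    have "orbit_sum n xs \<in> mixed_invariants n d 0" if "xs \<in> ?R" for xs
    proof -
      have "ys \<in> {ys. length ys = d \<and> set ys \<subseteq> {1..n}}" if "ys \<in> word_orbit n xs" for ys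
        using that \<open>xs \<in> ?R\<close> word_orbit_letters[of ys n xs]
        by (simp add: orbit_representatives_def)
      moreover have "Poly_Mapping.keys (orbit_sum n xs) \<subseteq> FWord ` word_orbit n xs"
        unfolding orbit_sum_def by (rule order_trans[OF keys_sum]) auto
      ultimately have "Poly_Mapping.keys (orbit_sum n xs) \<subseteq> words n d"
        by (fastforce simp: words_def)
      then show ?thesis
        using perm_act_orbit_sum by (simp add: mixed_invariants_def sym_group_carrier)
    qed
    then show "free_alg.span (orbit_sum n ` ?R) \<subseteq> mixed_invariants n d 0"
      by (intro free_alg.span_minimal subspace_mixed_invariants) auto
  next
    show "mixed_invariants n d 0 \<subseteq> free_alg.span (orbit_sum n ` ?R)"
    proof
      fix f assume f: "f \<in> mixed_invariants n d 0"
      have inv: "Poly_Mapping.lookup f (FWord (map \<sigma> xs)) = Poly_Mapping.lookup f (FWord xs)"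
        if "\<sigma> permutes {1..n}" for \<sigma> xs
        using that f lookup_perm_act[OF permutes_inj[OF that], of f xs]
        by (simp add: mixed_invariants_def sym_group_carrier)
      have "f = (\<Sum>xs\<in>?R. scale (Poly_Mapping.lookup f (FWord xs)) (orbit_sum n xs))" (is "f = ?g")
      proof (rule poly_mapping_eqI)
        fix w :: "nat fword"
        obtain ys where ys: "w = FWord ys" by (cases w)
        have g: "Poly_Mapping.lookup ?g w =
          (\<Sum>xs\<in>?R. Poly_Mapping.lookup f (FWord xs) * (if ys \<in> word_orbit n xs then 1 else 0))"
          by (simp add: ys lookup_sum lookup_orbit_sum)
        show "Poly_Mapping.lookup f w = Poly_Mapping.lookup ?g w"
        proof (cases "length ys = d \<and> set ys \<subseteq> {1..n}")
          case True
          obtain \<sigma> where \<sigma>: "\<sigma> permutes {1..n}" "map \<sigma> ys \<in> ?R"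
            using orbit_representative_exists[of ys n] True by blast
          have iff: "ys \<in> word_orbit n xs \<longleftrightarrow> xs = map \<sigma> ys" if "xs \<in> ?R" for xs
          proof
            assume "ys \<in> word_orbit n xs"
            then obtain \<tau> where \<tau>: "\<tau> permutes {1..n}" "ys = map \<tau> xs" by (auto simp: word_orbit_def)
            have "map (\<sigma> \<circ> \<tau>) xs = xs"
              using \<tau> \<sigma> that by (intro orbit_representative_unique permutes_compose) auto
            then show "xs = map \<sigma> ys" using \<tau> by simp
          next
            assume "xs = map \<sigma> ys"
            then have "ys = map (inv' \<sigma>) xs"
              using \<sigma>(1) by (simp add: map_idI permutes_inverses(2))
            then show "ys \<in> word_orbit n xs"
              unfolding word_orbit_def using permutes_inv[OF \<sigma>(1)] by blast
          qed
          have "Poly_Mapping.lookup ?g w =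
            (\<Sum>xs\<in>?R. if xs = map \<sigma> ys then Poly_Mapping.lookup f (FWord xs) else 0)"
            unfolding g by (rule sum.cong) (auto simp: iff)
          also have "\<dots> = Poly_Mapping.lookup f (FWord ys)"
            using \<sigma> inv finite_orbit_representatives by simp
          finally show ?thesis by (simp add: ys)
        next
          case False
          have "ys \<notin> word_orbit n xs" if "xs \<in> ?R" for xs
          proof
            assume "ys \<in> word_orbit n xs"
            then show False
              using False that word_orbit_letters[of ys n xs]
              by (simp add: orbit_representatives_def)
          qed
          then have "Poly_Mapping.lookup ?g w = 0" unfolding g by simp
          moreover have "w \<notin> Poly_Mapping.keys f"
            using False f by (force simp: mixed_invariants_def words_def ys)
          ultimately show ?thesis by (simp add: in_keys_iff)
        qed
      qed
      also have "\<dots> \<in> free_alg.span (orbit_sum n ` ?R)"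
        by (intro free_alg.span_sum free_alg.span_scale free_alg.span_base) auto
      finally show "f \<in> free_alg.span (orbit_sum n ` ?R)" .
    qed
  qed
  then show ?thesis
    unfolding has_dim_def
    using independent_dual_family[of ?R "orbit_sum n" FWord] dual finite_orbit_representatives
    by (intro exI[of _ "orbit_sum n ` ?R"]) (simp add: card_image)
qed

text \<open>Induction on \<open>b\<close>: the recursions of the dimensions and of the numbers of closed words express the value
  at \<open>(a, b + 1)\<close> by the values at \<open>(a + 1, b)\<close> and \<open>(a, b)\<close>.\<close>
lemma has_dim_mixed_invariants:
  assumes "n \<ge> 1"
  shows "has_dim (mixed_invariants n a b) (card (closed_words n a b))"
proof (induction b arbitrary: a)
  case 0
  then show ?case by (simp add: has_dim_mixed_invariants_0 card_closed_words_0)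
next
  case (Suc b)
  obtain k where "has_dim (mixed_invariants n a (Suc b)) k"
    "card (closed_words n (Suc a) b) = k + card (closed_words n a b)"
    using has_dim_mixed_invariants_step[OF assms Suc Suc] by blast
  then show ?case using card_closed_words_step[OF assms, of a b] by simp
qed

section \<open>Words in homogeneous free generators\<close>

text \<open>The length of an arbitrary word of \<open>f\<close>, which is the degree if \<open>f\<close> is homogeneous and nonzero.\<close>
definition free_degree :: "'a free_alg \<Rightarrow> nat"
  where "free_degree f = length (letters (SOME w. w \<in> Poly_Mapping.keys f))"

lemma free_degree_contraction_kernel:
  assumes "f \<in> contraction_kernel n d" "f \<noteq> 0"
  shows "free_degree f = d"
proof -
  have "\<exists>w. w \<in> Poly_Mapping.keys f"
    using assms(2) by (simp add: ex_in_conv)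
  then have "(SOME w. w \<in> Poly_Mapping.keys f) \<in> Poly_Mapping.keys f"
    by (rule someI_ex)
  then show ?thesis
    using assms(1) by (auto simp: free_degree_def contraction_kernel_def words_def)
qed

lemma keys_scale: "Poly_Mapping.keys (scale c f) \<subseteq> Poly_Mapping.keys f"
  by (auto simp: in_keys_iff)

lemma contraction_kernel_0:
  assumes "f \<in> contraction_kernel n 0"
  obtains c where "f = scale c 1"
proof -
  have "letters w = []" if "w \<in> Poly_Mapping.keys f" for w
    using that assms by (auto simp: contraction_kernel_def words_def)
  then have "Poly_Mapping.lookup f w = 0" if "w \<noteq> 0" for w
    using that by (metis fword.collapse in_keys_iff zero_fword_def)
  then have "f = Poly_Mapping.single 0 (Poly_Mapping.lookup f 0)"
    by (intro poly_mapping_eqI) (auto simp: lookup_single when_def)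
  also have "\<dots> = scale (Poly_Mapping.lookup f 0) (Poly_Mapping.single 0 1)"
    by (simp only: scale_single mult_1_right)
  finally have "f = scale (Poly_Mapping.lookup f 0) 1"
    by (simp only: single_one)
  then show thesis by (rule that)
qed

locale homogeneous_free_generators =
  fixes n :: nat and B :: "nat free_alg set"
  assumes free: "freely_generates B (invariant_algebra n)"
    and homogeneous: "\<forall>b\<in>B. \<exists>e. b \<in> tensor_power (geometric_module n) e"
begin

lemma ev_inj: "inj_on (lift_hom (\<lambda>b. b)) (free_alg_on B)"
  and ev_image: "lift_hom (\<lambda>b. b) ` free_alg_on B = invariant_algebra n"
  using free by (auto simp: freely_generates_def bij_betw_def)

lemma monomial_free_alg_on: "set bs \<subseteq> B \<Longrightarrow> Poly_Mapping.single (FWord bs) 1 \<in> free_alg_on B"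
  by (simp add: free_alg_on_def)

lemma ev_monomial: "lift_hom (\<lambda>b. b) (Poly_Mapping.single (FWord bs) 1) = prod_list bs"
  by (simp add: lift_hom_single)

text \<open>A scalar would have two preimages in the free algebra, itself and a variable.\<close>
lemma generator_not_scalar:
  assumes "b \<in> B"
  shows "b \<noteq> scale c 1"
proof
  assume b: "b = scale c 1"
  have one: "scale c 1 \<in> free_alg_on B"
    using keys_scale[of c "1 :: nat free_alg free_alg"] by (auto simp: free_alg_on_def zero_fword_def)
  have "lift_hom (\<lambda>b. b) (scale c 1) = scale c (1 :: nat free_alg)"
    by (simp add: lift_hom_scale lift_hom_1)
  also have "\<dots> = lift_hom (\<lambda>b. b) (var b)"
    by (simp add: lift_hom_var b)
  finally have "scale c 1 = var b"
    using inj_onD[OF ev_inj _ one] monomial_free_alg_on[of "[b]"] assms by (simp add: var_def)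
  then have "Poly_Mapping.lookup (scale c 1) (FWord [b]) = Poly_Mapping.lookup (var b) (FWord [b])"
    by simp
  then show False
    by (simp add: var_def lookup_one when_def zero_fword_def)
qed

text \<open>Degree \<open>0\<close> is excluded because generators are not scalars; this makes the splitting of words by their
  first letter a recursion on smaller degrees.\<close>
lemma generator_degree:
  assumes "b \<in> B"
  shows "b \<in> contraction_kernel n (free_degree b)" "free_degree b \<ge> 1"
    and "b \<in> contraction_kernel n e \<longleftrightarrow> e = free_degree b"
proof -
  have "b \<noteq> 0" using generator_not_scalar[OF assms, of 0] by simp
  obtain e' where "b \<in> contraction_kernel n e'"
    using homogeneous assms by (auto simp: tensor_power_eq_contraction_kernel)
  then show b: "b \<in> contraction_kernel n (free_degree b)"
    using free_degree_contraction_kernel \<open>b \<noteq> 0\<close> by metis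
  have "free_degree b \<noteq> 0"
    using b contraction_kernel_0 generator_not_scalar[OF assms] by metis
  then show "free_degree b \<ge> 1" by simp
  show "b \<in> contraction_kernel n e \<longleftrightarrow> e = free_degree b"
    using b free_degree_contraction_kernel \<open>b \<noteq> 0\<close> by metis
qed

definition generator_words :: "nat \<Rightarrow> nat free_alg list set"
  where "generator_words d = {bs. set bs \<subseteq> B \<and> sum_list (map free_degree bs) = d}"

definition generators_of_degree :: "nat \<Rightarrow> nat free_alg set"
  where "generators_of_degree k = {b \<in> B. free_degree b = k}"

lemma prod_generators: "set bs \<subseteq> B \<Longrightarrow> prod_list bs \<in> contraction_kernel n (sum_list (map free_degree bs))"
  using generator_degree(1) by (intro prod_list_contraction_kernel) auto

text \<open>An invariant element of degree \<open>d\<close> is a combination of words in the generators. The words are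
  homogeneous, so those of degree other than \<open>d\<close> can be left out.\<close>
lemma span_generator_words:
  "free_alg.span (prod_list ` generator_words d) = mixed_invariants n 0 d"
proof
  have "prod_list bs \<in> mixed_invariants n 0 d" if "bs \<in> generator_words d" for bs
  proof -
    have bs: "set bs \<subseteq> B" "sum_list (map free_degree bs) = d"
      using that by (auto simp: generator_words_def)
    have "prod_list bs \<in> invariant_algebra n"
      using monomial_free_alg_on[OF bs(1)] ev_image ev_monomial by (metis imageI)
    then show ?thesis
      using prod_generators[OF bs(1)] bs(2)
      by (simp add: mixed_invariants_0 tensor_power_eq_contraction_kernel)
  qed
  then show "free_alg.span (prod_list ` generator_words d) \<subseteq> mixed_invariants n 0 d"
    by (intro free_alg.span_minimal subspace_mixed_invariants) auto
next
  show "mixed_invariants n 0 d \<subseteq> free_alg.span (prod_list ` generator_words d)"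
  proof
    fix f assume f: "f \<in> mixed_invariants n 0 d"
    then have "f \<in> lift_hom (\<lambda>b. b) ` free_alg_on B"
      unfolding ev_image by (simp add: mixed_invariants_0)
    then obtain g where g: "g \<in> free_alg_on B" "f = lift_hom (\<lambda>b. b) g"
      by blast
    let ?t = "\<lambda>u. scale (Poly_Mapping.lookup g u) (prod_list (letters u))"
    let ?D = "{u \<in> Poly_Mapping.keys g. sum_list (map free_degree (letters u)) = d}"
    have "f = (\<Sum>u\<in>?D. ?t u)"
    proof (rule poly_mapping_eqI)
      fix w
      have zero: "Poly_Mapping.lookup (?t u) w = 0"
        if "u \<in> Poly_Mapping.keys g" "sum_list (map free_degree (letters u)) \<noteq> length (letters w)" for u
      proof -
        have "set (letters u) \<subseteq> B" using g(1) that(1) by (auto simp: free_alg_on_def)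
        then have "w \<notin> Poly_Mapping.keys (prod_list (letters u))"
          using prod_generators[of "letters u"] that(2) by (auto simp: contraction_kernel_def words_def)
        then show ?thesis by (simp add: in_keys_iff)
      qed
      show "Poly_Mapping.lookup f w = Poly_Mapping.lookup (\<Sum>u\<in>?D. ?t u) w"
      proof (cases "length (letters w) = d")
        case True
        have "Poly_Mapping.lookup f w = (\<Sum>u\<in>Poly_Mapping.keys g. Poly_Mapping.lookup (?t u) w)"
          by (simp add: g(2) lift_hom_def lookup_sum)
        also have "\<dots> = (\<Sum>u\<in>?D. Poly_Mapping.lookup (?t u) w)"
          using zero True by (intro sum.mono_neutral_right) auto
        finally show ?thesis by (simp add: lookup_sum)
      next
        case False
        have "w \<notin> Poly_Mapping.keys f"
          using f False by (auto simp: mixed_invariants_def words_def)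
        moreover have "(\<Sum>u\<in>?D. Poly_Mapping.lookup (?t u) w) = 0"
          using zero False by (intro sum.neutral) auto
        ultimately show ?thesis by (simp add: lookup_sum in_keys_iff)
      qed
    qed
    also have "\<dots> \<in> free_alg.span (prod_list ` generator_words d)"
      using g(1)
      by (intro free_alg.span_sum free_alg.span_scale free_alg.span_base imageI)
        (auto simp: free_alg_on_def generator_words_def)
    finally show "f \<in> free_alg.span (prod_list ` generator_words d)" .
  qed
qed

lemma independent_generator_words:
  "inj_on prod_list (generator_words d)" "free_alg.independent (prod_list ` generator_words d)"
proof -
  interpret ev: Vector_Spaces.linear scale scale "lift_hom (\<lambda>b :: nat free_alg. b)"
    by unfold_locales (simp_all add: lift_hom_add lift_hom_scale)
  let ?m = "\<lambda>bs :: nat free_alg list. Poly_Mapping.single (FWord bs) (1 :: rat)"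
  have ind: "free_alg.independent (?m ` generator_words d)"
    by (rule independent_dual_family(2)[where x = FWord]) (auto simp: lookup_single when_def)
  have sub: "?m ` generator_words d \<subseteq> free_alg_on B"
    using monomial_free_alg_on by (auto simp: generator_words_def)
  then have "inj_on (lift_hom (\<lambda>b. b)) (free_alg.span (?m ` generator_words d))"
    by (intro inj_on_subset[OF ev_inj] free_alg.span_minimal free_subspace)
  then have "free_alg.independent (lift_hom (\<lambda>b. b) ` ?m ` generator_words d)"
    by (rule ev.independent_injective_image[OF ind])
  then show "free_alg.independent (prod_list ` generator_words d)"
    by (simp add: image_image ev_monomial)
  show "inj_on prod_list (generator_words d)"
  proof (rule inj_onI)
    fix bs cs assume *: "bs \<in> generator_words d" "cs \<in> generator_words d" "prod_list bs = prod_list cs"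
    then have "?m bs = ?m cs"
      using inj_onD[OF ev_inj] sub by (metis ev_monomial image_subset_iff)
    then have "Poly_Mapping.lookup (?m bs) (FWord cs) = 1" by simp
    then show "bs = cs" by (auto simp: lookup_single when_def split: if_splits)
  qed
qed

lemma card_generator_words:
  assumes "n \<ge> 1"
  shows "finite (generator_words d)" "card (generator_words d) = card (closed_words n 0 d)"
proof -
  have dim: "has_dim (mixed_invariants n 0 d) (card (closed_words n 0 d))"
    using has_dim_mixed_invariants[OF assms] .
  then obtain A where A: "finite A" "free_alg.span A = mixed_invariants n 0 d"
    by (auto simp: has_dim_def)
  have "prod_list ` generator_words d \<subseteq> free_alg.span A"
    unfolding A(2) span_generator_words[symmetric] by (rule free_alg.span_superset)
  then have fin: "finite (prod_list ` generator_words d)"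
    using free_alg.independent_span_bound[OF A(1) independent_generator_words(2)] by blast
  then show "finite (generator_words d)"
    using finite_imageD independent_generator_words(1) by blast
  have "has_dim (mixed_invariants n 0 d) (card (generator_words d))"
    unfolding has_dim_def using fin independent_generator_words[of d] span_generator_words[of d]
    by (intro exI[of _ "prod_list ` generator_words d"]) (simp add: card_image)
  then show "card (generator_words d) = card (closed_words n 0 d)"
    using dim by (rule has_dim_unique)
qed

lemma finite_generators_of_degree:
  assumes "n \<ge> 1"
  shows "finite (generators_of_degree k)"
proof -
  have "(\<lambda>b. [b]) ` generators_of_degree k \<subseteq> generator_words k"
    by (auto simp: generators_of_degree_def generator_words_def)
  then have "finite ((\<lambda>b. [b]) ` generators_of_degree k)"
    using card_generator_words(1)[OF assms] finite_subset by blast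
  then show ?thesis by (rule finite_imageD) (simp add: inj_on_def)
qed

lemma card_generator_words_recursion:
  assumes "n \<ge> 1" "d \<ge> 1"
  shows "card (generator_words d) =
    (\<Sum>k=1..d. card (generators_of_degree k) * card (generator_words (d - k)))"
proof -
  have "bij_betw (\<lambda>(k, b, bs). b # bs)
    (SIGMA k:{1..d}. generators_of_degree k \<times> generator_words (d - k)) (generator_words d)"
  proof (rule bij_betw_imageI)
    show "inj_on (\<lambda>(k, b, bs). b # bs)
        (SIGMA k:{1..d}. generators_of_degree k \<times> generator_words (d - k))"
      by (auto simp: inj_on_def generators_of_degree_def)
    have "bs \<in> (\<lambda>(k, b, bs). b # bs) ` (SIGMA k:{1..d}. generators_of_degree k \<times> generator_words (d - k))"
      if "bs \<in> generator_words d" for bs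
    proof (cases bs)
      case Nil
      then show ?thesis using that assms(2) by (simp add: generator_words_def)
    next
      case (Cons b cs)
      then show ?thesis
        using that generator_degree(2)[of b]
        by (intro image_eqI[of _ _ "(free_degree b, b, cs)"])
          (auto simp: generator_words_def generators_of_degree_def)
    qed
    then show "(\<lambda>(k, b, bs). b # bs) `
        (SIGMA k:{1..d}. generators_of_degree k \<times> generator_words (d - k)) = generator_words d"
      by (auto simp: generator_words_def generators_of_degree_def)
  qed
  then have "card (generator_words d) =
      card (SIGMA k:{1..d}. generators_of_degree k \<times> generator_words (d - k))"
    by (rule bij_betw_same_card[symmetric])
  also have "\<dots> = (\<Sum>k=1..d. card (generators_of_degree k) * card (generator_words (d - k)))"
    by (subst card_SigmaI)
      (simp_all add: finite_generators_of_degree[OF assms(1)] card_generator_words(1)[OF assms(1)]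
        card_cartesian_product)
  finally show ?thesis .
qed

lemma generator_words_0: "generator_words 0 = {[]}"
proof -
  have "bs = []" if "bs \<in> generator_words 0" for bs
    using that generator_degree(2) by (cases bs) (force simp: generator_words_def)+
  then show ?thesis by (auto simp: generator_words_def)
qed

end

section \<open>Closed walks and first returns\<close>

definition closed_cayley_words :: "('g, 'm) monoid_scheme \<Rightarrow> 'g set \<Rightarrow> nat \<Rightarrow> 'g list set"
  where "closed_cayley_words G S d = {w \<in> cayley_words S d. reduces_to G w \<one>\<^bsub>G\<^esub>}"

definition first_returns :: "('g, 'm) monoid_scheme \<Rightarrow> 'g set \<Rightarrow> nat \<Rightarrow> 'g list set"
  where "first_returns G S d =
    {w \<in> cayley_words S d. reduces_to G w \<one>\<^bsub>G\<^esub> \<and> \<not> crosses_identity G w}"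

lemma (in monoid) reduces_to_append:
  assumes "set u \<subseteq> carrier G" "set v \<subseteq> carrier G" "reduces_to G u \<one>"
  shows "reduces_to G (u @ v) \<one> \<longleftrightarrow> reduces_to G v \<one>"
proof -
  have closed: "foldr (\<otimes>) w \<one> \<in> carrier G" if "set w \<subseteq> carrier G" for w
    using that by (induction w) auto
  have "foldr (\<otimes>) (u @ v) \<one> = foldr (\<otimes>) u \<one> \<otimes> foldr (\<otimes>) v \<one>"
    using assms(1)
  proof (induction u)
    case Nil
    then show ?case using closed[OF assms(2)] by simp
  next
    case (Cons x u)
    then show ?case using closed[of u] closed[OF assms(2)] by (simp add: m_assoc)
  qed
  then show ?thesis
    using assms(3) closed[OF assms(2)] by (simp add: reduces_to_def)
qed

text \<open>Cut a closed walk at its first return to the identity.\<close>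
lemma (in monoid) card_closed_cayley_words:
  assumes S: "finite S" "S \<subseteq> carrier G" and "d \<ge> 1"
  shows "card (closed_cayley_words G S d) =
    (\<Sum>k=1..d. card (first_returns G S k) * card (closed_cayley_words G S (d - k)))"
proof -
  let ?T = "SIGMA k:{1..d}. first_returns G S k \<times> closed_cayley_words G S (d - k)"
  let ?app = "\<lambda>(k, u, v). u @ v"
  have fin: "finite (cayley_words S k)" for k
    unfolding cayley_words_def using finite_lists_length_eq[OF S(1), of k] by (simp add: conj_commute)
  have "bij_betw ?app ?T (closed_cayley_words G S d)"
  proof (rule bij_betw_imageI)
    have no_shorter: "\<not> length u < length u'"
      if "u @ v = u' @ v'" "u \<in> first_returns G S k" "k \<ge> 1" "u' \<in> first_returns G S k'" for u v u' v' k k'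
    proof
      assume less: "length u < length u'"
      then have "u = take (length u) u'"
        using that(1) by (metis append_eq_append_conv_if less_imp_le linorder_not_less)
      then have "crosses_identity G u'"
        using that less unfolding crosses_identity_def first_returns_def cayley_words_def by auto
      then show False using that(4) by (simp add: first_returns_def)
    qed
    show "inj_on ?app ?T"
    proof (rule inj_onI)
      fix x y assume xy: "x \<in> ?T" "y \<in> ?T" "?app x = ?app y"
      obtain k u v k' u' v' where eq: "x = (k, u, v)" "y = (k', u', v')"
        by (metis prod_cases3)
      have "length u = length u'"
        using xy no_shorter[of u v u' v' k k'] no_shorter[of u' v' u v k' k] unfolding eq by fastforce
      moreover have "length u = k" "length u' = k'"
        using xy unfolding eq by (auto simp: first_returns_def cayley_words_def)
      ultimately show "x = y" using xy(3) unfolding eq by simp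
    qed
    show "?app ` ?T = closed_cayley_words G S d"
    proof
      show "?app ` ?T \<subseteq> closed_cayley_words G S d"
      proof clarify
        fix k u v assume *: "k \<in> {1..d}" "u \<in> first_returns G S k" "v \<in> closed_cayley_words G S (d - k)"
        then show "u @ v \<in> closed_cayley_words G S d"
          using reduces_to_append[of u v] S(2)
          by (auto simp: first_returns_def closed_cayley_words_def cayley_words_def)
      qed
      show "closed_cayley_words G S d \<subseteq> ?app ` ?T"
      proof
        fix w assume w: "w \<in> closed_cayley_words G S d"
        let ?P = "\<lambda>k. 1 \<le> k \<and> k \<le> d \<and> reduces_to G (take k w) \<one>"
        define k where "k = (LEAST k. ?P k)"
        have len: "length w = d" "set w \<subseteq> S" "reduces_to G w \<one>"
          using w by (auto simp: closed_cayley_words_def cayley_words_def)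
        have "?P d" using len assms(3) by simp
        then have k: "?P k" unfolding k_def by (rule LeastI)
        have least: "\<not> reduces_to G (take j w) \<one>" if "1 \<le> j" "j < k" for j
          using that k not_less_Least[of j ?P] unfolding k_def by auto
        have sets: "set (take k w) \<subseteq> S" "set (drop k w) \<subseteq> S"
          using len(2) by (auto dest: in_set_takeD in_set_dropD)
        have "take k w \<in> first_returns G S k"
          using k len sets least
          by (auto simp: first_returns_def cayley_words_def crosses_identity_def min_def)
        moreover have "drop k w \<in> closed_cayley_words G S (d - k)"
          using reduces_to_append[of "take k w" "drop k w"] sets S(2) k len
          by (auto simp: closed_cayley_words_def cayley_words_def)
        ultimately show "w \<in> ?app ` ?T"
          using k by (intro image_eqI[of _ _ "(k, take k w, drop k w)"]) auto
      qed
    qed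
  qed
  then have "card (closed_cayley_words G S d) = card ?T"
    by (rule bij_betw_same_card[symmetric])
  also have "\<dots> = (\<Sum>k=1..d. card (first_returns G S k) * card (closed_cayley_words G S (d - k)))"
    by (subst card_SigmaI)
      (auto simp: first_returns_def closed_cayley_words_def fin card_cartesian_product)
  finally show ?thesis .
qed

lemma cayley_cycle_inj: "inj_on cayley_cycle {1..n}"
proof (rule inj_onI)
  fix k l assume "k \<in> {1..n}" "l \<in> {1..n}" "cayley_cycle k = cayley_cycle l"
  then have "k # [1..<k] @ [Suc k..<Suc n] = l # [1..<l] @ [Suc l..<Suc n]"
    using map_cayley_cycle by metis
  then show "k = l" by simp
qed

lemma card_closed_cayley_words_closed_words:
  "card (closed_cayley_words (sym_group n) (cayley_gens n) d) = card (closed_words n 0 d)"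
proof -
  have "bij_betw (map cayley_cycle) (closed_words n 0 d) (closed_cayley_words (sym_group n) (cayley_gens n) d)"
  proof (rule bij_betw_imageI)
    have "inj_on (map cayley_cycle) (lists {1..n})"
      using cayley_cycle_inj by (rule inj_on_mapI[OF inj_on_subset]) auto
    then show "inj_on (map cayley_cycle) (closed_words n 0 d)"
      by (rule inj_on_subset) (auto simp: closed_words_def)
    have closed: "reduces_to (sym_group n) (map cayley_cycle ks) \<one>\<^bsub>sym_group n\<^esub> \<longleftrightarrow> cycle_product ks = id" for ks
      by (simp add: reduces_to_def cycle_product_def sym_group_def)
    show "map cayley_cycle ` closed_words n 0 d = closed_cayley_words (sym_group n) (cayley_gens n) d"
    proof
      show "map cayley_cycle ` closed_words n 0 d \<subseteq> closed_cayley_words (sym_group n) (cayley_gens n) d"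
      proof clarify
        fix ks assume ks: "ks \<in> closed_words n 0 d"
        then have "set (map cayley_cycle ks) \<subseteq> cayley_gens n"
          unfolding cayley_gens_def set_map by (intro image_mono) (simp add: closed_words_def)
        then show "map cayley_cycle ks \<in> closed_cayley_words (sym_group n) (cayley_gens n) d"
          using ks closed by (simp add: closed_words_def closed_cayley_words_def cayley_words_def)
      qed
      show "closed_cayley_words (sym_group n) (cayley_gens n) d \<subseteq> map cayley_cycle ` closed_words n 0 d"
      proof
        fix w assume w: "w \<in> closed_cayley_words (sym_group n) (cayley_gens n) d"
        then have "w \<in> lists (cayley_cycle ` {2..n})"
          by (auto simp: closed_cayley_words_def cayley_words_def cayley_gens_def)
        then obtain ks where "ks \<in> lists {2..n}" "w = map cayley_cycle ks"
          unfolding lists_image by blast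
        moreover from this have "cycle_product ks = id" "length ks = d"
          using w closed by (auto simp: closed_cayley_words_def cayley_words_def)
        moreover have "set ks \<subseteq> {1..n}" using \<open>ks \<in> lists {2..n}\<close> by fastforce
        ultimately show "w \<in> map cayley_cycle ` closed_words n 0 d"
          by (auto simp: closed_words_def)
      qed
    qed
  qed
  then show ?thesis by (rule bij_betw_same_card[symmetric])
qed

section \<open>Comparison of the two recursions\<close>

lemma renewal_unique:
  fixes a p h :: "nat \<Rightarrow> nat"
  assumes "h 0 = 1"
    and "\<And>d. d \<ge> 1 \<Longrightarrow> h d = (\<Sum>k=1..d. a k * h (d - k))"
    and "\<And>d. d \<ge> 1 \<Longrightarrow> h d = (\<Sum>k=1..d. p k * h (d - k))"
    and "d \<ge> 1"
  shows "a d = p d"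
  using assms(4)
proof (induction d rule: less_induct)
  case (less d)
  have split: "(\<Sum>k=1..d. q k * h (d - k)) = (\<Sum>k=1..<d. q k * h (d - k)) + q d" for q
    using less.prems assms(1) by (simp add: sum.last_plus atLeastLessThanSuc_atLeastAtMost[symmetric])
  have "(\<Sum>k=1..<d. a k * h (d - k)) = (\<Sum>k=1..<d. p k * h (d - k))"
    using less.IH by (intro sum.cong) auto
  then show ?case
    using assms(2,3)[OF less.prems] split[of a] split[of p] by simp
qed

theorem proposition4p13:
  fixes n d :: nat and B :: "nat free_alg set"
  assumes "n \<ge> 2"
    and "freely_generates B (invariant_algebra n)"
    and "\<forall>b\<in>B. \<exists>e. b \<in> tensor_power (geometric_module n) e"
    and "d \<ge> 1"
  shows "finite {b \<in> B. b \<in> tensor_power (geometric_module n) d} \<and>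
    card {b \<in> B. b \<in> tensor_power (geometric_module n) d} =
    card {w \<in> cayley_words (cayley_gens n) d.
      reduces_to (sym_group n) w \<one>\<^bsub>sym_group n\<^esub> \<and> \<not> crosses_identity (sym_group n) w}"
proof -
  interpret homogeneous_free_generators n B
    using assms(2,3) by unfold_locales
  interpret group "sym_group n" by (rule sym_group_is_group)
  have n: "n \<ge> 1" using assms(1) by simp
  let ?S = "cayley_gens n"
  let ?h = "\<lambda>d. card (closed_words n 0 d)"
  have S: "finite ?S" "?S \<subseteq> carrier (sym_group n)"
    using cayley_cycle_permutes by (auto simp: cayley_gens_def sym_group_carrier)
  have "card (generators_of_degree d) = card (first_returns (sym_group n) ?S d)"
  proof (rule renewal_unique[of ?h "\<lambda>k. card (generators_of_degree k)"
        "\<lambda>k. card (first_returns (sym_group n) ?S k)"])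
    show "?h 0 = 1"
      using card_generator_words(2)[OF n, of 0] by (simp add: generator_words_0)
    show "?h e = (\<Sum>k=1..e. card (generators_of_degree k) * ?h (e - k))" if "e \<ge> 1" for e
      using card_generator_words_recursion[OF n that] card_generator_words(2)[OF n] by simp
    show "?h e = (\<Sum>k=1..e. card (first_returns (sym_group n) ?S k) * ?h (e - k))" if "e \<ge> 1" for e
      using card_closed_cayley_words[OF S that] by (simp add: card_closed_cayley_words_closed_words)
  qed (fact assms(4))
  moreover have "{b \<in> B. b \<in> tensor_power (geometric_module n) d} = generators_of_degree d"
    using generator_degree(3) by (auto simp: generators_of_degree_def tensor_power_eq_contraction_kernel)
  ultimately show ?thesis
    using finite_generators_of_degree[OF n] by (simp add: first_returns_def)
qed

end
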